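(* Fix $n\ge1$. Let $T(k,a,b,c)$ be the set of permutation tableaux contained in a $k\times(n-k)$ rectangle (with $k$ rows and $n-k$ columns) which are filled with precisely $a$ $0$'s, $b$ $1$'s and $c$ $2$'s. Let $P(k,a,b,c)$ be the set of all permutations $\pi\in\mathcal{S}_n$ such that - $k-1=\mathrm{des}(\pi)$, - $a=(31\text{-}2)\pi+(21\text{-}3)\pi+(3\text{-}21)\pi-\binom{\mathrm{des}\,\pi}{2}$, - $b=(2\text{-}31)\pi+n-1-\mathrm{des}\,\pi$, - $c=(1\text{-}32)\pi+(32\text{-}1)\pi-\binom{\mathrm{des}\,\pi}{2}$. Then $|T(k,a,b,c)|=|P(k,a,b,c)|$.
   Context: **Permutation tableaux.** A permutation tableau contained in a $k\times(n-k)$ rectangle is a partition $\lambda=(\lambda_1\ge\dots\ge\lambda_k\ge 0)$ with $\lambda_1\le n-k$, whose Young diagram $Y_\lambda$ (left-justified, $\lambda_i$ boxes in the $i$-th row from the top) is placed in the top left corner of the rectangle, together with a filling of the boxes of $Y_\lambda$ by $0$'s and $1$'s such that: (1) each of the $n-k$ columns of the rectangle contains at least one $1$; (2) there is no $0$ which has a $1$ above it in the same column and a $1$ to its left in the same row. Rows of length $0$ are allowed. Every box of the rectangle outside $Y_\lambda$ is filled with a $2$. **Patterns.** For $\pi=a_1\cdots a_n\in\mathcal{S}_n$, $\mathrm{des}(\pi)$ is the number of $i$ with $a_i>a_{i+1}$. For a generalized pattern $p$ (a permutation of $1,2,3$ written with a dash between some adjacent letters), $(p)\pi$ denotes the number of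 occurrences of $p$ in $\pi$: subsequences of $\pi$ of length $3$ whose letters are in the same relative order as those of $p$, where letters of $p$ not separated by a dash must correspond to adjacent letters of $\pi$ (a dash imposes no adjacency restriction). *)

theory Defs
  imports Complex_Main "HOL-Library.FuncSet" "HOL-Combinatorics.Multiset_Permutations"
begin

text \<open>
  Rows and columns are numbered from 0, so a partition is a weakly decreasing list of row
  lengths, in which rows of length 0 are allowed.
\<close>

definition partitions_in_rectangle :: "nat \<Rightarrow> nat \<Rightarrow> nat list set" where
  "partitions_in_rectangle k m =
     {lam. length lam = k \<and> sorted_wrt (\<ge>) lam \<and> (\<forall>x\<in>set lam. x \<le> m)}"

definition young_diagram :: "nat list \<Rightarrow> (nat \<times> nat) set" where
  "young_diagram lam = {(i, j). i < length lam \<and> j < lam ! i}"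

text \<open>
  The filling is a function on all boxes of the rectangle. It is extensional (undefined outside
  the rectangle), so that distinct functions are distinct fillings.
\<close>

definition permutation_tableaux ::
    "nat \<Rightarrow> nat \<Rightarrow> (nat list \<times> (nat \<times> nat \<Rightarrow> nat)) set" where
  "permutation_tableaux k m =
     {(lam, F). lam \<in> partitions_in_rectangle k m \<and>
        F \<in> extensional ({..<k} \<times> {..<m}) \<and>
        (\<forall>x\<in>young_diagram lam. F x \<in> {0, 1}) \<and>
        (\<forall>x\<in>{..<k} \<times> {..<m} - young_diagram lam. F x = 2) \<and>
        (\<forall>j<m. \<exists>i<k. F (i, j) = 1) \<and>
        \<not> (\<exists>(i, j)\<in>young_diagram lam. F (i, j) = 0 \<and>
             (\<exists>i'<i. F (i', j) = 1) \<and> (\<exists>j'<j. F (i, j') = 1))}"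

definition num_entries :: "nat \<Rightarrow> nat \<Rightarrow> (nat \<times> nat \<Rightarrow> nat) \<Rightarrow> nat \<Rightarrow> nat" where
  "num_entries k m F v = card {x \<in> {..<k} \<times> {..<m}. F x = v}"

definition tableaux_T ::
    "nat \<Rightarrow> nat \<Rightarrow> nat \<Rightarrow> nat \<Rightarrow> nat \<Rightarrow> (nat list \<times> (nat \<times> nat \<Rightarrow> nat)) set" where
  "tableaux_T n k a b c =
     {(lam, F) \<in> permutation_tableaux k (n - k).
        num_entries k (n - k) F 0 = a \<and>
        num_entries k (n - k) F 1 = b \<and>
        num_entries k (n - k) F 2 = c}"

text \<open>A permutation is written as the word of its values; positions are numbered from 0.\<close>

definition des :: "nat list \<Rightarrow> nat" where
  "des w = card {i. Suc i < length w \<and> w ! i > w ! Suc i}"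

text \<open>
  A generalized pattern is the list of its blocks of letters not separated by a dash: 31-2 is
  \<open>[[3, 1], [2]]\<close>. The positions \<open>s\<close> and \<open>s + 1\<close> of the underlying word \<open>concat p\<close> are separated
  by a dash iff \<open>s + 1\<close> is the total length of an initial segment of the blocks. An occurrence is
  represented by the increasing list of its positions in \<open>w\<close>.
\<close>

definition pattern_occurrences :: "nat list list \<Rightarrow> nat list \<Rightarrow> nat list set" where
  "pattern_occurrences p w =
     {is. length is = length (concat p) \<and> sorted_wrt (<) is \<and> set is \<subseteq> {..<length w} \<and>
        (\<forall>s<length is. \<forall>t<length is.
           w ! (is ! s) < w ! (is ! t) \<longleftrightarrow> concat p ! s < concat p ! t) \<and>
        (\<forall>s. Suc s < length is \<and> (\<forall>r. Suc s \<noteq> length (concat (take r p))) \<longrightarrow>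
           is ! Suc s = Suc (is ! s))}"

definition pattern_count :: "nat list list \<Rightarrow> nat list \<Rightarrow> nat" where
  "pattern_count p w = card (pattern_occurrences p w)"

text \<open>
  The four conditions are equations between integers, so that neither \<open>k - 1\<close> nor the
  subtracted terms are truncated at 0.
\<close>

definition permutations_P :: "nat \<Rightarrow> nat \<Rightarrow> nat \<Rightarrow> nat \<Rightarrow> nat \<Rightarrow> nat list set" where
  "permutations_P n k a b c =
     {w \<in> permutations_of_set {1..n}.
        int k - 1 = int (des w) \<and>
        int a = int (pattern_count [[3, 1], [2]] w) + int (pattern_count [[2, 1], [3]] w)
                + int (pattern_count [[3], [2, 1]] w) - int (des w choose 2) \<and>
        int b = int (pattern_count [[2], [3, 1]] w) + int n - 1 - int (des w) \<and>
        int c = int (pattern_count [[1], [3, 2]] w) + int (pattern_count [[3, 2], [1]] w)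
                - int (des w choose 2)}"

end

theory Submission
  imports Defs "HOL-Computational_Algebra.Polynomial"
begin

text \<open>
  Read the boundary path of the shape of a tableau from north east to south west and number its
  steps from 0; the shape is then the set of the numbers of its vertical steps. This set contains
  0, and its other elements play the role of the descent bottoms of a permutation: they
  determine the number of 2's, resp. the number of occurrences of 1-32 and 32-1, and these agree.
  For a fixed set it remains to compare the distributions of the number of 1's and of 2-31. Both
  generating functions satisfy the recursion \<open>DE = q ED + D + E\<close> for a vertical step \<open>D\<close> followed
  by a horizontal step \<open>E\<close>. For tableaux it arises by removing a corner box together with, if
  necessary, its row or column. For permutations it is refined by the last letter: appending a
  letter creates a number of occurrences of 2-31 that depends only on the last two letters.
  The number of 0's is then determined as well, since both triples have the same sum.
\<close>

section \<open>Appending a letter to a permutation\<close>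

text \<open>On tableaux the recursion literally reads \<open>DE = q ED + D + q E\<close>, because
  deleting a column whose only 1 sits in the corner loses that 1. Dividing by q to the power of the
  number of columns gives the form stated for permutations; there are n - 1 - des columns, which is
  the origin of this summand in b. For permutations no bijection is constructed: the recursion is
  derived algebraically from the transition weights between the last two letters, and the
  cardinalities are compared as coefficients of equal polynomials. Since the recursion deletes steps
  and letters, label sets are arbitrary finite sets without renumbering, and
  \<open>consecutive\<close> replaces the successor. Why a set of bottoms fixes c: an occurrence of
  1-32 or 32-1 is a descent together with a letter below its bottom, so a bottom y accounts for y -
  1 of them; for given n and k the number of boxes of a shape is a constant minus the sum of its row
  labels. The extra row label 0 turns des bottoms into k = des + 1 rows, and shifts labels so that y
  - 1 fits.\<close>

definition consecutive :: "nat set \<Rightarrow> nat \<Rightarrow> nat \<Rightarrow> bool" where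
  "consecutive V i i' \<longleftrightarrow> i \<in> V \<and> i' \<in> V \<and> i < i' \<and> (\<forall>x\<in>V. x \<le> i \<or> i' \<le> x)"

lemma consecutiveD:
  assumes "consecutive V i i'"
  shows "i \<in> V" "i' \<in> V" "i < i'" "i \<noteq> i'" "x \<in> V \<Longrightarrow> i < x \<Longrightarrow> x < i' \<Longrightarrow> False"
  using assms by (auto simp: consecutive_def)

definition desc_bottoms :: "nat list \<Rightarrow> nat set" where
  "desc_bottoms w = {w ! Suc j | j. Suc j < length w \<and> w ! j > w ! Suc j}"

definition count231 :: "nat list \<Rightarrow> nat" where
  "count231 w = card {(i, j). i < j \<and> Suc j < length w \<and> w ! Suc j < w ! i \<and> w ! i < w ! j}"

lemma desc_bottoms_subset: "desc_bottoms w \<subseteq> set w"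
  by (auto simp: desc_bottoms_def)

lemma desc_bottoms_snoc:
  assumes "w \<noteq> []"
  shows "desc_bottoms (w @ [a]) = desc_bottoms w \<union> (if a < last w then {a} else {})"
proof -
  have eq: "(Suc j < length (w @ [a]) \<and> (w @ [a]) ! j > (w @ [a]) ! Suc j) \<longleftrightarrow>
        (Suc j < length w \<and> w ! j > w ! Suc j) \<or> (Suc j = length w \<and> a < last w)" for j
  proof (cases "Suc j = length w")
    case True
    then have "last w = w ! j"
      using assms by (metis diff_Suc_1 last_conv_nth)
    with True show ?thesis
      by (auto simp: nth_append)
  qed (auto simp: nth_append)
  have last: "Suc (length w - 1) = length w"
    using assms by simp
  show ?thesis
    unfolding desc_bottoms_def eq
  proof (intro set_eqI iffI)
    fix x assume "x \<in> {w ! Suc j | j. Suc j < length w \<and> w ! j > w ! Suc j} \<union>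
      (if a < last w then {a} else {})"
    then consider j where "x = w ! Suc j" "Suc j < length w" "w ! j > w ! Suc j"
      | "x = a" "a < last w"
      by (auto split: if_splits)
    then show "x \<in> {(w @ [a]) ! Suc j | j. Suc j < length w \<and> w ! j > w ! Suc j
                                      \<or> Suc j = length w \<and> a < last w}"
    proof cases
      case 1
      then show ?thesis
        by (auto simp: nth_append intro!: exI[of _ j])
    next
      case 2
      then show ?thesis
        using last by (auto simp: nth_append intro!: exI[of _ "length w - 1"])
    qed
  qed (auto simp: nth_append split: if_splits)
qed

text \<open>A new occurrence has its 31 in the last two positions, and its 2 is any letter whose
  value lies strictly between theirs. Since letters are distinct, such positions may be counted as
  letters.\<close>

lemma count231_snoc:
  assumes "w \<noteq> []" "distinct w"
  shows "count231 (w @ [a]) = count231 w + card {b \<in> set w. a < b \<and> b < last w}"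
proof -
  define old where
    "old = {(i, j). i < j \<and> Suc j < length w \<and> w ! Suc j < w ! i \<and> w ! i < w ! j}"
  define I where "I = {i. i < length w \<and> a < w ! i \<and> w ! i < last w}"
  have last: "last w = w ! (length w - 1)"
    using assms by (simp add: last_conv_nth)
  have "{(i, j). i < j \<and> Suc j < length (w @ [a]) \<and> (w @ [a]) ! Suc j < (w @ [a]) ! i
          \<and> (w @ [a]) ! i < (w @ [a]) ! j} = old \<union> (\<lambda>i. (i, length w - 1)) ` I"
    (is "?L = ?R")
  proof (rule set_eqI, clarify)
    fix i j
    show "(i, j) \<in> ?L \<longleftrightarrow> (i, j) \<in> ?R"
    proof (cases "Suc j = length w")
      case True
      have "(i, j) \<in> ?L \<longleftrightarrow> i < j \<and> a < w ! i \<and> w ! i < last w"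
        using True by (auto simp: nth_append last simp flip: True)
      also have "\<dots> \<longleftrightarrow> i \<in> I"
        using True last by (auto simp: I_def less_Suc_eq simp flip: True)
      also have "\<dots> \<longleftrightarrow> (i, j) \<in> ?R"
        using True by (auto simp: old_def simp flip: True)
      finally show ?thesis .
    next
      case False
      then have "j \<noteq> length w - 1"
        using assms by auto
      then show ?thesis
        using False by (auto simp: old_def nth_append)
    qed
  qed
  moreover have "finite old"
    by (rule finite_subset[of _ "{..<length w} \<times> {..<length w}"]) (auto simp: old_def)
  moreover have "finite I"
    by (simp add: I_def)
  moreover have "old \<inter> (\<lambda>i. (i, length w - 1)) ` I = {}"
    by (auto simp: old_def)
  moreover have "card ((\<lambda>i. (i, length w - 1)) ` I) = card I"
    by (rule card_image) (auto simp: inj_on_def)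
  moreover have "card I = card {b \<in> set w. a < b \<and> b < last w}"
  proof (rule bij_betw_same_card)
    show "bij_betw ((!) w) I {b \<in> set w. a < b \<and> b < last w}"
      using assms by (auto simp: bij_betw_def I_def inj_on_def nth_eq_iff_index_eq in_set_conv_nth)
  qed
  ultimately show ?thesis
    by (simp add: count231_def old_def card_Un_disjoint)
qed

definition perms_ending :: "nat set \<Rightarrow> nat set \<Rightarrow> nat \<Rightarrow> nat list set" where
  "perms_ending V D a = {w \<in> permutations_of_set V. w \<noteq> [] \<and> last w = a \<and> desc_bottoms w = D}"

definition gf_ending :: "'a::comm_ring_1 \<Rightarrow> nat set \<Rightarrow> nat set \<Rightarrow> nat \<Rightarrow> 'a" where
  "gf_ending q V D a = (\<Sum>w\<in>perms_ending V D a. q ^ count231 w)"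

definition gf_perms :: "'a::comm_ring_1 \<Rightarrow> nat set \<Rightarrow> nat set \<Rightarrow> 'a" where
  "gf_perms q V D = (\<Sum>w\<in>{w \<in> permutations_of_set V. desc_bottoms w = D}. q ^ count231 w)"

text \<open>Transition weight for a last letter a preceded by c. All letters of V between a and c
  stand to the left of a, so the number of new occurrences of 2-31 does not depend on the rest of
  the word. The value 0 excludes a step in the wrong direction.\<close>

definition snoc_weight :: "'a::comm_ring_1 \<Rightarrow> nat set \<Rightarrow> nat set \<Rightarrow> nat \<Rightarrow> nat \<Rightarrow> 'a" where
  "snoc_weight q V D a c = (if a \<in> D then if a < c then q ^ card (V \<inter> {a<..<c}) else 0
                     else if c < a then 1 else 0)"

lemma finite_perms_ending: "finite (perms_ending V D a)"
  by (simp add: perms_ending_def)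

lemma gf_perms_eq_sum_ending:
  assumes "finite V" "V \<noteq> {}"
  shows "gf_perms q V D = (\<Sum>a\<in>V. gf_ending q V D a)"
proof -
  have "{w \<in> permutations_of_set V. desc_bottoms w = D} = (\<Union>a\<in>V. perms_ending V D a)"
  proof (intro equalityI subsetI)
    fix w assume w: "w \<in> {w \<in> permutations_of_set V. desc_bottoms w = D}"
    then have "w \<noteq> []" "set w = V"
      using assms by (auto simp: permutations_of_set_def)
    then have "last w \<in> V"
      using last_in_set by blast
    then show "w \<in> (\<Union>a\<in>V. perms_ending V D a)"
      using w \<open>w \<noteq> []\<close> by (simp add: perms_ending_def)
  qed (auto simp: perms_ending_def)
  then show ?thesis
    unfolding gf_perms_def gf_ending_def using assms
    by (simp, subst sum.UNION_disjoint)
       (simp_all add: finite_perms_ending, auto simp: perms_ending_def)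
qed

lemma gf_ending_singleton: "gf_ending q {v} {} v = 1"
proof -
  have "perms_ending {v} {} v = {[v]}"
    by (auto simp: perms_ending_def desc_bottoms_def)
  then show ?thesis
    by (simp add: gf_ending_def count231_def)
qed

text \<open>The last letter is a descent bottom exactly if its predecessor is larger. It does not
  occur in the shorter word, whose set of bottoms is therefore \<open>D - {a}\<close>.\<close>

lemma perms_ending_snoc:
  assumes "a \<in> V" "D \<subseteq> V" "V \<noteq> {a}"
  shows "perms_ending V D a =
           (\<lambda>w. w @ [a]) ` (\<Union>c\<in>{c \<in> V - {a}. if a \<in> D then a < c else c < a}.
                             perms_ending (V - {a}) (D - {a}) c)" (is "?L = ?R")
proof (intro equalityI subsetI)
  fix w assume w: "w \<in> ?L"
  then obtain w' where w': "w = w' @ [a]"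
    by (auto simp: perms_ending_def) (metis append_butlast_last_id)
  have mem: "w' \<in> permutations_of_set (V - {a})"
    using w by (auto simp: w' perms_ending_def permutations_of_set_def)
  then have ne: "w' \<noteq> []"
    using assms by (auto simp: permutations_of_set_def)
  then have last: "last w' \<in> V - {a}"
    using mem last_in_set[OF ne] by (auto simp: permutations_of_set_def)
  have a: "a \<notin> desc_bottoms w'"
    using mem desc_bottoms_subset[of w'] by (auto simp: permutations_of_set_def)
  have D: "D = desc_bottoms w' \<union> (if a < last w' then {a} else {})"
    using w by (auto simp: perms_ending_def w' desc_bottoms_snoc[OF ne])
  have D': "a \<in> D \<longleftrightarrow> a < last w'" "desc_bottoms w' = D - {a}"
    using a by (subst D, simp)+
  have "w' \<in> perms_ending (V - {a}) (D - {a}) (last w')"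
    using mem ne D'(2) by (simp add: perms_ending_def)
  moreover have "last w' \<in> {c \<in> V - {a}. if a \<in> D then a < c else c < a}"
    using last D'(1) by simp
  ultimately have "w' \<in> (\<Union>c\<in>{c \<in> V - {a}. if a \<in> D then a < c else c < a}.
                             perms_ending (V - {a}) (D - {a}) c)"
    by (rule UN_I[rotated])
  then show "w \<in> ?R"
    unfolding w' by (rule imageI)
next
  fix w assume "w \<in> ?R"
  then obtain w' c where w: "w = w' @ [a]"
    and c': "c \<in> {c \<in> V - {a}. if a \<in> D then a < c else c < a}"
    and w': "w' \<in> perms_ending (V - {a}) (D - {a}) c"
    by (elim imageE UN_E)
  from c' have c: "c \<in> V - {a}" "if a \<in> D then a < c else c < a"
    by simp_all
  have w'': "w' \<noteq> []" "last w' = c" "desc_bottoms w' = D - {a}" "set w' = V - {a}" "distinct w'"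
    using w' by (simp_all add: perms_ending_def permutations_of_set_def)
  have "desc_bottoms w = D"
    unfolding w desc_bottoms_snoc[OF w''(1)] w'' using c by (cases "a \<in> D") auto
  moreover have "w \<in> permutations_of_set V"
    using w''(4,5) assms(1) by (auto simp: w permutations_of_set_def)
  ultimately show "w \<in> ?L"
    by (simp add: perms_ending_def w)
qed

lemma gf_ending_rec:
  assumes "finite V" "a \<in> V" "D \<subseteq> V" "V \<noteq> {a}"
  shows "gf_ending q V D a =
           (\<Sum>c\<in>V - {a}. snoc_weight q V D a c * gf_ending q (V - {a}) (D - {a}) c)"
proof -
  let ?C = "{c \<in> V - {a}. if a \<in> D then a < c else c < a}"
  have "gf_ending q V D a =
      (\<Sum>w\<in>(\<Union>c\<in>?C. perms_ending (V - {a}) (D - {a}) c). q ^ count231 (w @ [a]))"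
    unfolding gf_ending_def perms_ending_snoc[OF assms(2-)]
    by (subst sum.reindex) (auto simp: inj_on_def)
  also have "\<dots> = (\<Sum>c\<in>?C. \<Sum>w\<in>perms_ending (V - {a}) (D - {a}) c. q ^ count231 (w @ [a]))"
    using assms by (subst sum.UNION_disjoint) (auto simp: finite_perms_ending perms_ending_def)
  also have "\<dots> = (\<Sum>c\<in>?C. snoc_weight q V D a c * gf_ending q (V - {a}) (D - {a}) c)"
    unfolding gf_ending_def sum_distrib_left
  proof (intro sum.cong refl)
    fix c w assume c: "c \<in> ?C" and w: "w \<in> perms_ending (V - {a}) (D - {a}) c"
    have w': "w \<noteq> []" "distinct w" "last w = c" "set w = V - {a}"
      using w by (simp_all add: perms_ending_def permutations_of_set_def)
    have "{b \<in> set w. a < b \<and> b < last w} = V \<inter> {a<..<c}"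
      unfolding w' by auto
    then have cnt: "count231 (w @ [a]) = count231 w + card (V \<inter> {a<..<c})"
      using count231_snoc[OF w'(1,2)] by simp
    have "q ^ card (V \<inter> {a<..<c}) = snoc_weight q V D a c"
      using c by (cases "a \<in> D") (simp_all add: snoc_weight_def)
    then show "q ^ count231 (w @ [a]) = snoc_weight q V D a c * q ^ count231 w"
      unfolding cnt power_add by (simp only: mult.commute)
  qed
  also have "\<dots> = (\<Sum>c\<in>V - {a}. snoc_weight q V D a c * gf_ending q (V - {a}) (D - {a}) c)"
    using assms by (intro sum.mono_neutral_left) (auto simp: snoc_weight_def)
  finally show ?thesis .
qed

section \<open>The recursion for permutations\<close>

lemma gf_ending_singleton_self: "gf_ending q {v} {v} v = 0"
proof -
  have "perms_ending {v} {v} v = {}"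
    by (auto simp: perms_ending_def desc_bottoms_def)
  then show ?thesis
    by (simp add: gf_ending_def)
qed

text \<open>The recursion sees letters only through comparisons and through the sizes of intervals,
  and an increasing map preserves both. Hence the induction never has to look at words.\<close>

lemma gf_ending_image:
  assumes "finite V" "D \<subseteq> V" "a \<in> V" "strict_mono_on V f"
  shows "gf_ending q (f ` V) (f ` D) (f a) = gf_ending q V D a"
  using assms
proof (induction "card V" arbitrary: V D a)
  case 0
  then show ?case by auto
next
  case (Suc m)
  note mono = strict_mono_onD[OF Suc.prems(4)]
  have inj: "inj_on f V"
    using Suc.prems by (simp add: strict_mono_on_imp_inj_on)
  show ?case
  proof (cases "V = {a}")
    case True
    with Suc.prems have "D = {} \<or> D = {a}" by auto
    then show ?thesis
      by (auto simp: True gf_ending_singleton gf_ending_singleton_self)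
  next
    case False
    have less: "f x < f y \<longleftrightarrow> x < y" if "x \<in> V" "y \<in> V" for x y
      using mono[of x y] mono[of y x] that by (cases x y rule: linorder_cases) auto
    have ne: "f ` V \<noteq> {f a}"
    proof
      assume "f ` V = {f a}"
      then have "V \<subseteq> {a}"
        using inj Suc.prems(3) by (fastforce simp: inj_on_def)
      with False Suc.prems(3) show False by auto
    qed
    have im: "f ` V - {f a} = f ` (V - {a})" "f ` D - {f a} = f ` (D - {a})"
      using inj Suc.prems by (auto simp: inj_on_def)
    have memD: "f a \<in> f ` D \<longleftrightarrow> a \<in> D"
      using inj Suc.prems by (auto simp: inj_on_def)
    have snoc_weight: "snoc_weight q (f ` V) (f ` D) (f a) (f c) = snoc_weight q V D a c"
      if c: "c \<in> V" for c
    proof -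
      have "f ` V \<inter> {f a<..<f c} = f ` (V \<inter> {a<..<c})"
        using less c Suc.prems(3) by auto
      moreover have "card (f ` (V \<inter> {a<..<c})) = card (V \<inter> {a<..<c})"
        by (rule card_image) (rule inj_on_subset[OF inj], auto)
      ultimately show ?thesis
        using less c Suc.prems(3) by (simp add: snoc_weight_def memD)
    qed
    have IH: "gf_ending q (f ` (V - {a})) (f ` (D - {a})) (f c) = gf_ending q (V - {a}) (D - {a}) c"
      if "c \<in> V - {a}" for c
    proof (rule Suc.hyps(1))
      show "m = card (V - {a})"
        using Suc.hyps(2) Suc.prems by simp
      show "strict_mono_on (V - {a}) f"
        using mono by (auto intro: strict_mono_onI)
    qed (use Suc.prems that in auto)
    have "gf_ending q (f ` V) (f ` D) (f a) =
      (\<Sum>c\<in>f ` (V - {a}). snoc_weight q (f ` V) (f ` D) (f a) c *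
         gf_ending q (f ` (V - {a})) (f ` (D - {a})) c)"
      using Suc.prems ne by (subst gf_ending_rec) (auto simp: im)
    also have "\<dots> = (\<Sum>c\<in>V - {a}. snoc_weight q (f ` V) (f ` D) (f a) (f c) *
         gf_ending q (f ` (V - {a})) (f ` (D - {a})) (f c))"
      using inj_on_subset[OF inj, of "V - {a}"] by (simp add: sum.reindex)
    also have "\<dots> = (\<Sum>c\<in>V - {a}. snoc_weight q V D a c * gf_ending q (V - {a}) (D - {a}) c)"
      by (intro sum.cong refl) (simp add: snoc_weight IH)
    also have "\<dots> = gf_ending q V D a"
      using Suc.prems False by (subst (2) gf_ending_rec) auto
    finally show ?thesis .
  qed
qed

text \<open>Renaming i to i' is increasing on \<open>V - {i'}\<close> because no letter of V lies
  between the two. This identifies the two ways of deleting one letter of a consecutive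
  pair.\<close>

lemma gf_ending_relabel:
  assumes "finite V" "consecutive V i i'" "E \<subseteq> V - {i, i'}"
  shows "c \<in> V - {i, i'} \<Longrightarrow> gf_ending q (V - {i'}) E c = gf_ending q (V - {i}) E c"
    and "gf_ending q (V - {i'}) E i = gf_ending q (V - {i}) E i'"
    and "c \<in> V - {i, i'} \<Longrightarrow>
           gf_ending q (V - {i'}) (insert i E) c = gf_ending q (V - {i}) (insert i' E) c"
proof -
  define f where "f = (\<lambda>x. if x = i then i' else x)"
  note con = consecutiveD[OF assms(2)]
  have V: "f ` (V - {i'}) = V - {i}"
    using con by (auto simp: f_def image_iff)
  have E: "f ` E = E" "f ` insert i E = insert i' E"
    using assms(3) by (auto simp: f_def image_iff)
  have mono: "strict_mono_on (V - {i'}) f"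
  proof (rule strict_mono_onI)
    fix x y assume "x \<in> V - {i'}" "y \<in> V - {i'}" "x < y"
    then show "f x < f y"
      using con(3) con(5)[of x] con(5)[of y]
      by (auto simp: f_def not_less_iff_gr_or_eq) (metis nat_neq_iff)
  qed
  note im = gf_ending_image[of "V - {i'}" _ _ f q, unfolded V, OF _ _ _ mono]
  have sub: "E \<subseteq> V - {i'}" "insert i E \<subseteq> V - {i'}" "i \<in> V - {i'}"
    using assms(3) con by auto
  have f: "f i = i'" "c \<in> V - {i, i'} \<Longrightarrow> f c = c" for c
    by (auto simp: f_def)
  show "gf_ending q (V - {i'}) E c = gf_ending q (V - {i}) E c" if "c \<in> V - {i, i'}"
    using im[OF _ sub(1), of c] assms(1) that unfolding E f(2)[OF that] by simp
  show "gf_ending q (V - {i'}) E i = gf_ending q (V - {i}) E i'"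
    using im[OF _ sub(1,3)] assms(1) unfolding E f(1) by simp
  show "gf_ending q (V - {i'}) (insert i E) c = gf_ending q (V - {i}) (insert i' E) c"
    if "c \<in> V - {i, i'}"
    using im[OF _ sub(2), of c] assms(1) that unfolding E f(2)[OF that] by simp
qed

lemma sum_split_consecutive:
  fixes g :: "nat \<Rightarrow> 'a::comm_ring_1"
  assumes "finite V" "consecutive V i i'"
  shows "sum g V = sum g {c \<in> V. c < i} + g i + g i' + sum g {c \<in> V. i' < c}"
    and "sum g (V - {i}) = sum g {c \<in> V. c < i} + g i' + sum g {c \<in> V. i' < c}"
    and "sum g (V - {i'}) = sum g {c \<in> V. c < i} + g i + sum g {c \<in> V. i' < c}"
proof -
  let ?L = "{c \<in> V. c < i}" and ?B = "{c \<in> V. i' < c}"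
  note con = consecutiveD[OF assms(2)]
  have V: "V = insert i (insert i' (?L \<union> ?B))"
    using con by (auto dest!: con(5))
  have fin: "finite ?L" "finite ?B" "?L \<inter> ?B = {}" "i \<notin> ?L \<union> ?B" "i' \<notin> ?L \<union> ?B" "i \<noteq> i'"
    using assms con(3) by auto
  have LB: "sum g (?L \<union> ?B) = sum g ?L + sum g ?B"
    by (rule sum.union_disjoint) (use fin in auto)
  have eq: "V - {i} = insert i' (?L \<union> ?B)" "V - {i'} = insert i (?L \<union> ?B)"
    using fin V by blast+
  have "sum g V = g i + (g i' + sum g (?L \<union> ?B))"
    by (subst V) (use fin in simp)
  then show "sum g V = sum g ?L + g i + g i' + sum g ?B"
    by (simp add: LB)
  show "sum g (V - {i}) = sum g ?L + g i' + sum g ?B" "sum g (V - {i'}) = sum g ?L + g i + sum g ?B"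
    unfolding eq using fin by (simp_all add: LB)
qed

text \<open>The point is the common form of the right-hand sides: after relabelling, only
  \<open>V - {i}\<close> with bottoms E and \<open>V - {i'}\<close> with bottoms
  \<open>insert i E\<close> occur, the two smaller alphabets of the swap identity. The extra factor
  q in the first equation counts i', which lies between i and any c above i'.\<close>

lemma gf_ending_consecutive:
  assumes "finite V" "consecutive V i i'" "E \<subseteq> V - {i, i'}"
  shows "gf_ending q V (insert i E) i = gf_ending q (V - {i}) E i' +
           (\<Sum>c\<in>{c \<in> V. i' < c}. q * q ^ card (V \<inter> {i'<..<c}) * gf_ending q (V - {i}) E c)"
    and "gf_ending q V (insert i E) i' = (\<Sum>c\<in>{c \<in> V. c < i}. gf_ending q (V - {i'}) (insert i E) c)
           + gf_ending q (V - {i'}) (insert i E) i"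
    and "gf_ending q V (insert i' E) i =
           (\<Sum>c\<in>{c \<in> V. c < i}. gf_ending q (V - {i'}) (insert i E) c)"
    and "gf_ending q V (insert i' E) i' =
           (\<Sum>c\<in>{c \<in> V. i' < c}. q ^ card (V \<inter> {i'<..<c}) * gf_ending q (V - {i}) E c)"
proof -
  note con = consecutiveD[OF assms(2)]
  note split = sum_split_consecutive[OF assms(1,2)]
  have ne: "V \<noteq> {i}" "V \<noteq> {i'}"
    using con by auto
  have sub: "insert i E \<subseteq> V" "insert i' E \<subseteq> V"
    using assms(3) con by auto
  have notin: "i \<notin> E" "i' \<notin> E"
    using assms(3) by auto
  have D: "insert i E - {i} = E" "insert i E - {i'} = insert i E" "insert i' E - {i'} = E"
    "insert i' E - {i} = insert i' E"
    using notin con by auto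
  have card0: "V \<inter> {i<..<i'} = {}"
    using con(5) by auto
  have card1: "card (V \<inter> {i<..<c}) = Suc (card (V \<inter> {i'<..<c}))" if "i' < c" for c
  proof -
    have "V \<inter> {i<..<c} = insert i' (V \<inter> {i'<..<c})"
      using con that by (auto dest!: con(5))
    then show ?thesis
      using assms(1) by simp
  qed
  show "gf_ending q V (insert i E) i = gf_ending q (V - {i}) E i' +
           (\<Sum>c\<in>{c \<in> V. i' < c}. q * q ^ card (V \<inter> {i'<..<c}) * gf_ending q (V - {i}) E c)"
    unfolding gf_ending_rec[OF assms(1) con(1) sub(1) ne(1)] D split(2)
    using con(3) by (simp add: snoc_weight_def card0 card1)
  show "gf_ending q V (insert i E) i' = (\<Sum>c\<in>{c \<in> V. c < i}. gf_ending q (V - {i'}) (insert i E) c)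
           + gf_ending q (V - {i'}) (insert i E) i"
    unfolding gf_ending_rec[OF assms(1) con(2) sub(1) ne(2)] D split(3)
    using con(3) notin by (simp add: snoc_weight_def)
  show "gf_ending q V (insert i' E) i =
           (\<Sum>c\<in>{c \<in> V. c < i}. gf_ending q (V - {i'}) (insert i E) c)"
    unfolding gf_ending_rec[OF assms(1) con(1) sub(2) ne(1)] D split(2)
    using con(3) notin by (simp add: snoc_weight_def gf_ending_relabel[OF assms])
  show "gf_ending q V (insert i' E) i' =
           (\<Sum>c\<in>{c \<in> V. i' < c}. q ^ card (V \<inter> {i'<..<c}) * gf_ending q (V - {i}) E c)"
    unfolding gf_ending_rec[OF assms(1) con(2) sub(2) ne(2)] D split(3)
    using con(3) notin by (simp add: snoc_weight_def gf_ending_relabel[OF assms])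
qed

text \<open>
  Only the sum over \<open>j\<close> of this identity is needed, but it is the additional factor \<open>q\<close> for
  \<open>j < i\<close>, compensated at \<open>j = i\<close> and \<open>j = i'\<close>, that makes the induction possible.
\<close>

lemma gf_ending_swap:
  assumes "finite V" "consecutive V i i'" "E \<subseteq> V - {i, i'}" "j \<in> V - {i, i'}"
  shows "gf_ending q V (insert i E) j = q * gf_ending q V (insert i' E) j + gf_ending q (V - {i}) E j
           + (if j < i then q else 1) * gf_ending q (V - {i'}) (insert i E) j"
  using assms
proof (induction "card V" arbitrary: V E j)
  case 0
  then show ?case by auto
next
  case (Suc m)
  note con = consecutiveD[OF Suc.prems(2)]
  have j: "j \<in> V" "j \<noteq> i" "j \<noteq> i'" "j < i \<or> i' < j"
    using Suc.prems(2,4) by (auto simp: consecutive_def dest!: bspec[of _ _ j])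
  define V1 E1 where "V1 = V - {j}" and "E1 = E - {j}"
  have fin1: "finite V1" and con1: "consecutive V1 i i'" and E1: "E1 \<subseteq> V1 - {i, i'}"
    using Suc.prems j by (auto simp: V1_def E1_def consecutive_def)
  define a b w s where "a = gf_ending q V1 (insert i E1)" and "b = gf_ending q V1 (insert i' E1)"
    and "w = gf_ending q (V1 - {i}) E1" and "s = gf_ending q (V1 - {i'}) (insert i E1)"
  define L B where "L = {c \<in> V1. c < i}" and "B = {c \<in> V1. i' < c}"
  \<comment> \<open>\<open>\<rho>\<close> is the cost of one more letter of the pair lying between j
    and a larger predecessor; it arises only if j is a bottom below the pair.
    \<open>\<sigma>\<close> is the factor from the statement.\<close>
  define \<rho> \<sigma> where "\<rho> = (if j \<in> E \<and> j < i then q else 1)" and "\<sigma> = (if j < i then q else 1)"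
  define \<kappa> \<kappa>' where "\<kappa> = snoc_weight q V E j" and "\<kappa>' = snoc_weight q (V - {i}) E j"
  note split = sum_split_consecutive[OF fin1 con1, folded L_def B_def]

  have IH: "a c = q * b c + w c + (if c < i then q else 1) * s c" if "c \<in> V1 - {i, i'}" for c
    unfolding a_def b_def w_def s_def
    by (rule Suc.hyps(1)) (use Suc.hyps(2) fin1 con1 E1 j that in \<open>auto simp: V1_def\<close>)
  have IHL: "a c = q * b c + w c + q * s c" if "c \<in> L" for c
    using IH[of c] that con(1-4) by (auto simp: L_def)
  have IHB: "a c = q * b c + w c + s c" if "c \<in> B" for c
    using IH[of c] that con(1-4) by (auto simp: B_def)

  define SL SB where "SL = sum s L" and "SB = (\<Sum>c\<in>B. q ^ card (V1 \<inter> {i'<..<c}) * w c)"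
  have pair: "a i = w i' + q * SB" "a i' = SL + s i" "b i = SL" "b i' = SB"
    using gf_ending_consecutive[OF fin1 con1 E1, of q]
    by (simp_all add: a_def b_def w_def s_def SL_def SB_def L_def B_def sum_distrib_left mult.assoc)

  have snoc_weight_eq: "snoc_weight q V (insert i E) j = \<kappa>" "snoc_weight q V (insert i' E) j = \<kappa>"
    using j by (auto simp: \<kappa>_def snoc_weight_def)
  have card_i: "card (V \<inter> {j<..<i'}) = Suc (card (V \<inter> {j<..<i}))"
    "(V - {i}) \<inter> {j<..<i'} = V \<inter> {j<..<i}" "(V - {i'}) \<inter> {j<..<i} = V \<inter> {j<..<i}" if "j < i"
  proof -
    have "V \<inter> {j<..<i'} = insert i (V \<inter> {j<..<i})"
      using con(1-4) that by (auto dest!: con(5))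
    then show "card (V \<inter> {j<..<i'}) = Suc (card (V \<inter> {j<..<i}))"
      using Suc.prems(1) by simp
    show "(V - {i}) \<inter> {j<..<i'} = V \<inter> {j<..<i}" "(V - {i'}) \<inter> {j<..<i} = V \<inter> {j<..<i}"
      using con(1-4) that by (auto dest!: con(5))
  qed
  have \<kappa>_L: "\<kappa>' c = \<kappa> c" "snoc_weight q (V - {i'}) (insert i E) j c = \<kappa> c" if "c \<in> L" for c
  proof -
    have "(V - {i}) \<inter> {j<..<c} = V \<inter> {j<..<c}" "(V - {i'}) \<inter> {j<..<c} = V \<inter> {j<..<c}"
      using that con(1-4) by (auto simp: L_def)
    then show "\<kappa>' c = \<kappa> c" "snoc_weight q (V - {i'}) (insert i E) j c = \<kappa> c"
      using j by (auto simp: \<kappa>_def \<kappa>'_def snoc_weight_def)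
  qed
  have \<kappa>_i: "\<kappa> i' = \<rho> * \<kappa> i" "\<kappa>' i' = \<kappa> i" "snoc_weight q (V - {i'}) (insert i E) j i = \<kappa> i"
  proof -
    have mem: "j \<in> insert i E \<longleftrightarrow> j \<in> E"
      using j by simp
    have "\<kappa> i' = \<rho> * \<kappa> i \<and> \<kappa>' i' = \<kappa> i \<and> snoc_weight q (V - {i'}) (insert i E) j i = \<kappa> i"
    proof (cases "j < i")
      case True
      then have "j < i'"
        using con(3) by simp
      with True show ?thesis
        unfolding \<kappa>_def \<kappa>'_def snoc_weight_def \<rho>_def mem card_i[OF True] by simp
    next
      case False
      then have "i' < j" "i < j"
        using j con(3) by auto
      then show ?thesis
        unfolding \<kappa>_def \<kappa>'_def snoc_weight_def \<rho>_def mem by simp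
    qed
    then show "\<kappa> i' = \<rho> * \<kappa> i" "\<kappa>' i' = \<kappa> i" "snoc_weight q (V - {i'}) (insert i E) j i = \<kappa> i"
      by simp_all
  qed
  have card_B: "card (V \<inter> {j<..<c}) = Suc (card ((V - {i}) \<inter> {j<..<c}))"
    "card ((V - {i'}) \<inter> {j<..<c}) = card ((V - {i}) \<inter> {j<..<c})"
    "card ((V - {i}) \<inter> {j<..<c}) = card (V \<inter> {j<..<i}) + Suc (card (V1 \<inter> {i'<..<c}))"
    if "j < i" "c \<in> B" for c
  proof -
    define X where "X = (V \<inter> {j<..<i}) \<union> (V1 \<inter> {i'<..<c})"
    have X: "V \<inter> {j<..<c} = insert i (insert i' X)" "(V - {i}) \<inter> {j<..<c} = insert i' X"
      "(V - {i'}) \<inter> {j<..<c} = insert i X"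
      using con(1-4) that by (auto simp: X_def V1_def B_def dest!: con(5))
    have "finite X" "i \<notin> X" "i' \<notin> X"
      using Suc.prems(1) con(1-4) by (auto simp: X_def V1_def)
    moreover have "card X = card (V \<inter> {j<..<i}) + card (V1 \<inter> {i'<..<c})"
      unfolding X_def using Suc.prems(1) con(1-4) by (intro card_Un_disjoint) (auto simp: V1_def)
    ultimately show "card (V \<inter> {j<..<c}) = Suc (card ((V - {i}) \<inter> {j<..<c}))"
      "card ((V - {i'}) \<inter> {j<..<c}) = card ((V - {i}) \<inter> {j<..<c})"
      "card ((V - {i}) \<inter> {j<..<c}) = card (V \<inter> {j<..<i}) + Suc (card (V1 \<inter> {i'<..<c}))"
      unfolding X using con(4) by simp_all
  qed
  have card_B': "(V - {i}) \<inter> {j<..<c} = V \<inter> {j<..<c}" "(V - {i'}) \<inter> {j<..<c} = V \<inter> {j<..<c}"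
    if "i' < j" for c
    using con(1-4) that by auto
  have \<kappa>_B: "\<kappa> c = \<rho> * \<kappa>' c" "snoc_weight q (V - {i'}) (insert i E) j c = \<kappa>' c" if "c \<in> B" for c
  proof -
    have mem: "j \<in> insert i E \<longleftrightarrow> j \<in> E"
      using j by simp
    have "i' < c"
      using that by (simp add: B_def)
    have "\<kappa> c = \<rho> * \<kappa>' c \<and> snoc_weight q (V - {i'}) (insert i E) j c = \<kappa>' c"
    proof (cases "j < i")
      case True
      then have "j < c"
        using con(3) \<open>i' < c\<close> by simp
      with True show ?thesis
        unfolding \<kappa>_def \<kappa>'_def snoc_weight_def \<rho>_def mem card_B(1,2)[OF True that] by simp
    next
      case False
      then have "i' < j"
        using j by auto
      with False show ?thesis
        unfolding \<kappa>_def \<kappa>'_def snoc_weight_def \<rho>_def mem card_B'[OF \<open>i' < j\<close>] by simp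
    qed
    then show "\<kappa> c = \<rho> * \<kappa>' c" "snoc_weight q (V - {i'}) (insert i E) j c = \<kappa>' c"
      by simp_all
  qed

  \<comment> \<open>Removing the last letter j from all four terms of the claim leaves linear
    combinations of these six sums, of \<open>SL\<close>, \<open>SB\<close>, \<open>w i'\<close> and
    \<open>s i\<close>. On L all weights agree; on B the weight in V differs from the others by
    \<open>\<rho>\<close>.\<close>
  define Lb Lw Ls Bb Bw Bs where "Lb = (\<Sum>c\<in>L. \<kappa> c * b c)" and "Lw = (\<Sum>c\<in>L. \<kappa> c * w c)"
    and "Ls = (\<Sum>c\<in>L. \<kappa> c * s c)" and "Bb = (\<Sum>c\<in>B. \<kappa>' c * b c)" 
    and "Bw = (\<Sum>c\<in>B. \<kappa>' c * w c)" and "Bs = (\<Sum>c\<in>B. \<kappa>' c * s c)"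
  have ne: "V \<noteq> {j}" "V - {i} \<noteq> {j}" "V - {i'} \<noteq> {j}"
  proof -
    have "i \<in> V" "i' \<in> V - {i}" "i \<in> V - {i'}"
      using con(1-4) by auto
    then show "V \<noteq> {j}" "V - {i} \<noteq> {j}" "V - {i'} \<noteq> {j}"
      using j(2,3) by (metis singletonD)+
  qed
  have sub: "insert i E \<subseteq> V" "insert i' E \<subseteq> V" "E \<subseteq> V - {i}" "insert i E \<subseteq> V - {i'}"
    using Suc.prems(3) con(1-4) by auto
  have rem: "insert i E - {j} = insert i E1" "insert i' E - {j} = insert i' E1"
    "V - {i} - {j} = V1 - {i}" "V - {i'} - {j} = V1 - {i'}"
    using j by (auto simp: V1_def E1_def)

  have "(\<Sum>c\<in>L. \<kappa> c * a c) = q * Lb + Lw + q * Ls"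
    by (simp add: Lb_def Lw_def Ls_def IHL sum.distrib sum_distrib_left algebra_simps)
  moreover have "(\<Sum>c\<in>B. \<kappa> c * a c) = \<rho> * (q * Bb + Bw + Bs)"
    by (simp add: Bb_def Bw_def Bs_def IHB \<kappa>_B sum.distrib sum_distrib_left algebra_simps)
  ultimately have lhs: "gf_ending q V (insert i E) j = q * Lb + Lw + q * Ls + \<kappa> i * (w i' + q * SB)
      + \<rho> * \<kappa> i * (SL + s i) + \<rho> * (q * Bb + Bw + Bs)"
    using gf_ending_rec[OF Suc.prems(1) j(1) sub(1) ne(1), of q]
    by (simp add: rem split flip: V1_def a_def) (simp add: snoc_weight_eq pair \<kappa>_i)
  have "(\<Sum>c\<in>B. \<kappa> c * b c) = \<rho> * Bb"
    by (simp add: Bb_def \<kappa>_B sum_distrib_left algebra_simps)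
  then have t1: "gf_ending q V (insert i' E) j = Lb + \<kappa> i * SL + \<rho> * \<kappa> i * SB + \<rho> * Bb"
    using gf_ending_rec[OF Suc.prems(1) j(1) sub(2) ne(1), of q]
    by (simp add: rem split flip: V1_def b_def) (simp add: snoc_weight_eq pair \<kappa>_i Lb_def)
  have t2: "gf_ending q (V - {i}) E j = Lw + \<kappa> i * w i' + Bw"
    using gf_ending_rec[of "V - {i}" j E q] Suc.prems(1) j sub(3) ne(2)
    by (simp add: rem split flip: E1_def w_def \<kappa>'_def) (simp add: \<kappa>_L \<kappa>_i Lw_def Bw_def)
  have t3: "gf_ending q (V - {i'}) (insert i E) j = Ls + \<kappa> i * s i + Bs"
    using gf_ending_rec[of "V - {i'}" j "insert i E" q] Suc.prems(1) j sub(4) ne(3)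
    by (simp add: rem split flip: s_def) (simp add: \<kappa>_L \<kappa>_i \<kappa>_B Ls_def Bs_def)

  \<comment> \<open>This is the claim after cancelling the common terms. Of the four positions of j,
    only a bottom below i needs a genuine identity; otherwise the weights on one side of the pair
    vanish, and those on L are 1 when j is a non-bottom above the pair.\<close>
  have "\<kappa> i * q * SB + \<rho> * \<kappa> i * SL + q * Ls + \<rho> * \<kappa> i * s i + \<rho> * Bw + \<rho> * Bs
       = q * \<kappa> i * SL + q * \<rho> * \<kappa> i * SB + Bw + \<sigma> * Ls + \<sigma> * \<kappa> i * s i + \<sigma> * Bs"
  proof (cases "j < i")
    case True
    show ?thesis
    proof (cases "j \<in> E")
      case jE: True
      \<comment> \<open>For c above i', the letters of \<open>V - {i}\<close> between j and c are
        those between j and i, counted by \<open>\<kappa> i\<close>, then i' itself, then those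
        between i' and c, counted in \<open>SB\<close>.\<close>
      have "Bw = \<kappa> i * q * SB"
        unfolding Bw_def SB_def sum_distrib_left
      proof (intro sum.cong refl)
        fix c assume c: "c \<in> B"
        then have "\<kappa>' c = \<kappa> i * q * q ^ card (V1 \<inter> {i'<..<c})"
          using True jE con(1-4) card_B[OF True c]
            by (simp add: \<kappa>_def \<kappa>'_def snoc_weight_def B_def power_add)
        then show "\<kappa>' c * w c = \<kappa> i * q * (q ^ card (V1 \<inter> {i'<..<c}) * w c)"
          by simp
      qed
      then show ?thesis
        using True jE by (simp add: \<rho>_def \<sigma>_def algebra_simps)
    next
      case False
      then have "\<kappa> i = 0" "c \<in> B \<Longrightarrow> \<kappa>' c = 0" for c
        using True con(1-4) by (auto simp: \<kappa>_def \<kappa>'_def snoc_weight_def B_def)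
      then show ?thesis
        using True False by (simp add: \<rho>_def \<sigma>_def Bw_def Bs_def)
    qed
  next
    case False
    then have "i' < j"
      using j by simp
    show ?thesis
    proof (cases "j \<in> E")
      case True
      then have "\<kappa> i = 0" "c \<in> L \<Longrightarrow> \<kappa> c = 0" for c
        using \<open>i' < j\<close> con(1-4) by (auto simp: \<kappa>_def snoc_weight_def L_def)
      then show ?thesis
        using False by (simp add: \<rho>_def \<sigma>_def Ls_def)
    next
      case jE: False
      then have "\<kappa> i = 1" "c \<in> L \<Longrightarrow> \<kappa> c = 1" for c
        using \<open>i' < j\<close> con(1-4) by (auto simp: \<kappa>_def snoc_weight_def L_def)
      then show ?thesis
        using False by (simp add: \<rho>_def \<sigma>_def Ls_def SL_def)
    qed
  qed
  then show ?case
    unfolding lhs t1 t2 t3 \<sigma>_def[symmetric] by (simp add: algebra_simps)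
qed

lemma gf_perms_swap:
  assumes "finite V" "consecutive V i i'" "E \<subseteq> V - {i, i'}"
  shows "gf_perms q V (insert i E) =
           q * gf_perms q V (insert i' E) + gf_perms q (V - {i}) E
           + gf_perms q (V - {i'}) (insert i E)"
proof -
  note con = consecutiveD[OF assms(2)]
  note split = sum_split_consecutive[OF assms(1,2)]
  let ?L = "{c \<in> V. c < i}" and ?B = "{c \<in> V. i' < c}"
  define a b w s where "a = gf_ending q V (insert i E)" and "b = gf_ending q V (insert i' E)"
    and "w = gf_ending q (V - {i}) E" and "s = gf_ending q (V - {i'}) (insert i E)"
  have "a c = q * b c + w c + q * s c" if "c \<in> ?L" for c
    using gf_ending_swap[OF assms, of c q] that con(1-4) by (auto simp: a_def b_def w_def s_def)
  then have L: "sum a ?L = q * sum b ?L + sum w ?L + q * sum s ?L"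
    by (simp add: sum.distrib sum_distrib_left)
  have "a c = q * b c + w c + s c" if "c \<in> ?B" for c
    using gf_ending_swap[OF assms, of c q] that con(1-4) by (auto simp: a_def b_def w_def s_def)
  then have B: "sum a ?B = q * sum b ?B + sum w ?B + sum s ?B"
    by (simp add: sum.distrib sum_distrib_left)
  \<comment> \<open>\<open>sum s ?L\<close> is added with factor q on the left and factor 1 on the
    right: this is precisely the discrepancy that the letters below i leave in the summed
    identity.\<close>
  have pair: "a i + a i' + q * sum s ?L = q * (b i + b i') + w i' + s i + sum s ?L"
    using gf_ending_consecutive[OF assms, of q]
    by (simp add: a_def b_def w_def s_def sum_distrib_left algebra_simps)
  have "gf_perms q V (insert i E) = sum a V" "gf_perms q V (insert i' E) = sum b V"
    "gf_perms q (V - {i}) E = sum w (V - {i})"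
    "gf_perms q (V - {i'}) (insert i E) = sum s (V - {i'})"
    unfolding a_def b_def w_def s_def using assms(1) con(1-4) by (intro gf_perms_eq_sum_ending; auto)+
  then show ?thesis
    using pair by (simp add: split L B algebra_simps)
qed

section \<open>Boundary values of the recursion for permutations\<close>

lemma gf_ending_min:
  assumes "finite V" "m \<in> V" "\<And>x. x \<in> V \<Longrightarrow> m \<le> x" "D \<subseteq> V - {m}" "V \<noteq> {m}"
  shows "gf_ending q V D m = 0"
proof -
  have "snoc_weight q V D m c = 0" if "c \<in> V - {m}" for c
    using assms(3)[of c] assms(4) that by (auto simp: snoc_weight_def)
  then show ?thesis
    using assms by (subst gf_ending_rec) auto
qed

text \<open>A minimal letter that is no descent bottom must stand first, since any letter before it
  would be larger. In that place it starts no descent and is too small to be the 2 of a 2-31, so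
  deleting it changes neither statistic.\<close>

lemma gf_ending_remove_min:
  assumes "finite V" "m \<in> V" "\<And>x. x \<in> V \<Longrightarrow> m \<le> x" "D \<subseteq> V - {m}" "j \<in> V - {m}"
  shows "gf_ending q V D j = gf_ending q (V - {m}) D j"
  using assms
proof (induction "card V" arbitrary: V D j)
  case 0
  then show ?case by auto
next
  case (Suc k)
  have j: "j \<in> V" "j \<noteq> m" "m < j" and "V \<noteq> {j}"
    using Suc.prems(2,5) Suc.prems(3)[of j] by auto
  have rec: "gf_ending q V D j = snoc_weight q V D j m * gf_ending q (V - {j}) (D - {j}) m +
          (\<Sum>c\<in>V - {m} - {j}. snoc_weight q V D j c * gf_ending q (V - {j}) (D - {j}) c)"
  proof -
    have "V - {j} = insert m (V - {m} - {j})"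
      using Suc.prems(2) j by auto
    then have "(\<Sum>c\<in>V - {j}. snoc_weight q V D j c * gf_ending q (V - {j}) (D - {j}) c)
       = snoc_weight q V D j m * gf_ending q (V - {j}) (D - {j}) m +
          (\<Sum>c\<in>V - {m} - {j}. snoc_weight q V D j c * gf_ending q (V - {j}) (D - {j}) c)"
      using Suc.prems(1) by (subst sum.remove[of _ m]) (auto intro!: sum.cong)
    then show ?thesis
      using Suc.prems j \<open>V \<noteq> {j}\<close> by (subst gf_ending_rec) auto
  qed
  show ?case
  proof (cases "V - {m} = {j}")
    case True
    then have V: "V - {j} = {m}"
      using Suc.prems(2) j by blast
    have "D = {} \<or> D = {j}"
      using Suc.prems(4) unfolding True by auto
    then show ?thesis
      unfolding rec True V using j
      by (auto simp: gf_ending_singleton gf_ending_singleton_self snoc_weight_def)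
  next
    case False
    have "gf_ending q (V - {j}) (D - {j}) m = 0"
      by (rule gf_ending_min) (use Suc.prems j False in auto)
    then have "gf_ending q V D j =
        (\<Sum>c\<in>V - {m} - {j}. snoc_weight q V D j c * gf_ending q (V - {j}) (D - {j}) c)"
      by (simp add: rec)
    also have "\<dots> = (\<Sum>c\<in>V - {m} - {j}. snoc_weight q (V - {m}) D j c *
                      gf_ending q (V - {m} - {j}) (D - {j}) c)"
    proof (intro sum.cong refl)
      fix c assume c: "c \<in> V - {m} - {j}"
      have "gf_ending q (V - {j}) (D - {j}) c = gf_ending q (V - {j} - {m}) (D - {j}) c"
        by (rule Suc.hyps(1)) (use Suc.hyps(2) Suc.prems c j in auto)
      moreover have "V - {j} - {m} = V - {m} - {j}"
        by auto
      moreover have "(V - {m}) \<inter> {j<..<c} = V \<inter> {j<..<c}"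
        using j by auto
      ultimately show "snoc_weight q V D j c * gf_ending q (V - {j}) (D - {j}) c =
        snoc_weight q (V - {m}) D j c * gf_ending q (V - {m} - {j}) (D - {j}) c"
        by (simp add: snoc_weight_def)
    qed
    also have "\<dots> = gf_ending q (V - {m}) D j"
      using Suc.prems False by (subst (2) gf_ending_rec) auto
    finally show ?thesis .
  qed
qed

lemma gf_perms_remove_min:
  assumes "finite V" "m \<in> V" "\<And>x. x \<in> V \<Longrightarrow> m \<le> x" "D \<subseteq> V - {m}" "V \<noteq> {m}"
  shows "gf_perms q V D = gf_perms q (V - {m}) D"
proof -
  have "gf_perms q V D = gf_ending q V D m + (\<Sum>a\<in>V - {m}. gf_ending q V D a)"
    using assms(1,2) by (subst gf_perms_eq_sum_ending) (auto simp: sum.remove)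
  also have "\<dots> = (\<Sum>a\<in>V - {m}. gf_ending q (V - {m}) D a)"
    using assms by (auto simp: gf_ending_min gf_ending_remove_min intro!: sum.cong)
  also have "\<dots> = gf_perms q (V - {m}) D"
    using assms by (subst gf_perms_eq_sum_ending) auto
  finally show ?thesis .
qed

lemma desc_bottoms_less_Max: "x \<in> desc_bottoms w \<Longrightarrow> \<exists>y\<in>set w. x < y"
  by (auto simp: desc_bottoms_def intro!: bexI[of _ "w ! _"])

text \<open>The only such word is the decreasing one; it ends in the minimum and contains no
  2-31.\<close>

lemma gf_ending_all_bottoms:
  assumes "finite V" "c \<in> V"
  shows "gf_ending q V (V - {Max V}) c = (if c = Min V then 1 else 0)"
  using assms
proof (induction "card V" arbitrary: V c)
  case 0
  then show ?case by auto
next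
  case (Suc k)
  show ?case
  proof (cases "V = {c}")
    case True
    then show ?thesis
      by (simp add: gf_ending_singleton)
  next
    case Vc: False
    then have ne: "V - {c} \<noteq> {}"
      using Suc.prems by auto
    have "V \<noteq> {}"
      using Suc.prems by blast
    then have Min: "Min V \<in> V" "\<And>x. x \<in> V \<Longrightarrow> Min V \<le> x" and Max: "Max V \<in> V" "\<And>x. x \<in> V \<Longrightarrow> x \<le> Max V"
      using Suc.prems(1) by simp_all
    obtain x where x: "x \<in> V" "x \<noteq> c"
      using ne by blast
    have minmax: "Min V \<noteq> Max V"
      using x Min(2)[OF x(1)] Max(2)[OF x(1)] Min(2)[OF Suc.prems(2)] Max(2)[OF Suc.prems(2)]
      by linarith
    show ?thesis
    proof (cases "c = Max V")
      case True
      \<comment> \<open>With the maximum of V in last place, every remaining letter would have to be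
        a bottom, including the largest of them.\<close>
      have "perms_ending (V - {c}) (V - {c}) x = {}" for x
      proof (rule ccontr)
        assume "perms_ending (V - {c}) (V - {c}) x \<noteq> {}"
        then obtain w where w: "set w = V - {c}" "desc_bottoms w = V - {c}"
          by (auto simp: perms_ending_def permutations_of_set_def)
        then show False
          using desc_bottoms_less_Max[of "Max (V - {c})" w] ne Suc.prems(1)
          by (metis Max_ge Max_in finite_Diff leD)
      qed
      then have "gf_ending q (V - {c}) (V - {c}) x = 0" for x
        by (simp add: gf_ending_def)
      then have "gf_ending q V (V - {c}) c = 0"
        using gf_ending_rec[OF Suc.prems(1,2) Diff_subset Vc, of q] by simp
      moreover have "c \<noteq> Min V"
        using True minmax by metis
      ultimately show ?thesis
        unfolding True[symmetric] by simp
    next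
      case False
      define m where "m = Min (V - {c})"
      have m: "m \<in> V - {c}" "\<And>x. x \<in> V - {c} \<Longrightarrow> m \<le> x"
        using ne Suc.prems(1) Min_in[of "V - {c}"] by (auto simp: m_def)
      have "Max (V - {c}) = Max V"
        using False Max Suc.prems(1) by (intro Max_eqI) auto
      then have D: "V - {Max V} - {c} = V - {c} - {Max (V - {c})}"
        by auto
      have IH: "gf_ending q (V - {c}) (V - {Max V} - {c}) x = (if x = m then 1 else 0)"
        if "x \<in> V - {c}" for x
        unfolding D m_def by (rule Suc.hyps(1)) (use Suc.hyps(2) Suc.prems that in auto)
      have "gf_ending q V (V - {Max V}) c =
          (\<Sum>x\<in>V - {c}. snoc_weight q V (V - {Max V}) c x * (if x = m then 1 else 0))"
        using gf_ending_rec[OF Suc.prems(1,2) Diff_subset Vc, of q] by (simp add: IH)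
      also have "\<dots> = snoc_weight q V (V - {Max V}) c m"
        using m Suc.prems(1) by (simp add: if_distrib sum.delta cong: if_cong)
      also have "\<dots> = (if c = Min V then 1 else 0)"
      proof (cases "c = Min V")
        case True
        then have "c < m" "V \<inter> {c<..<m} = {}"
          using m Min by (auto simp: le_neq_implies_less) (metis Diff_iff leD singletonD nat_neq_iff)
        then show ?thesis
          using True False Suc.prems by (simp add: snoc_weight_def)
      next
        case c: False
        then have "m \<le> Min V"
          using Min by (intro m) auto
        then have "\<not> c < m"
          using Min(2)[OF Suc.prems(2)] by simp
        then show ?thesis
          using c False Suc.prems by (simp add: snoc_weight_def)
      qed
      finally show ?thesis .
    qed
  qed
qed

lemma gf_perms_all_bottoms:
  assumes "finite V" "V \<noteq> {}"
  shows "gf_perms q V (V - {Max V}) = 1"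
proof -
  have "gf_perms q V (V - {Max V}) = (\<Sum>c\<in>V. if c = Min V then 1 else 0)"
    using assms by (simp add: gf_perms_eq_sum_ending gf_ending_all_bottoms)
  then show ?thesis
    using assms by simp
qed

section \<open>The recursion for tableaux\<close>

text \<open>
  A filling is represented by the set of its 1's. The relations \<open>up\<close> and \<open>lf\<close> (``above'' and
  ``to the left of'') are parameters because rows and columns will be named both by coordinates
  and by labels of boundary steps, and columns are labelled from right to left.
\<close>

definition tab ::
    "('r \<Rightarrow> 'r \<Rightarrow> bool) \<Rightarrow> ('c \<Rightarrow> 'c \<Rightarrow> bool) \<Rightarrow> 'c set \<Rightarrow> ('r \<times> 'c) set \<Rightarrow> ('r \<times> 'c) set set" where
  "tab up lf C Y = {A. A \<subseteq> Y \<and> (\<forall>c\<in>C. \<exists>r. (r, c) \<in> A) \<and>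
     (\<forall>r c. (r, c) \<in> Y \<longrightarrow> (\<exists>r'. up r' r \<and> (r', c) \<in> A) \<longrightarrow> (\<exists>c'. lf c' c \<and> (r, c') \<in> A)
        \<longrightarrow> (r, c) \<in> A)}"

lemma finite_tab: "finite Y \<Longrightarrow> finite (tab up lf C Y)"
  by (rule finite_subset[of _ "Pow Y"]) (auto simp: tab_def)

text \<open>Used for two transports: exchanging the labels of the two steps at a corner, and passing
  from coordinates to boundary labels, which reverses the order of the columns. The relations need
  to correspond only on R and S, where the rows and columns of Y live.\<close>

lemma tab_image:
  assumes Y: "Y \<subseteq> R \<times> S" and C: "C \<subseteq> S" and f: "inj_on f R" and g: "inj_on g S"
    and up: "\<And>r r'. r \<in> R \<Longrightarrow> r' \<in> R \<Longrightarrow> up' (f r') (f r) \<longleftrightarrow> up r' r"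
    and lf: "\<And>c c'. c \<in> S \<Longrightarrow> c' \<in> S \<Longrightarrow> lf' (g c') (g c) \<longleftrightarrow> lf c' c"
  shows "tab up' lf' (g ` C) (map_prod f g ` Y) = (`) (map_prod f g) ` tab up lf C Y"
    and "inj_on ((`) (map_prod f g)) (tab up lf C Y)"
    and "A \<in> tab up lf C Y \<Longrightarrow> card (map_prod f g ` A) = card A"
proof -
  let ?h = "map_prod f g"
  have inj: "inj_on ?h Y"
    using map_prod_inj_on[OF f g] Y by (rule inj_on_subset)
  have mem: "(f r, g c) \<in> ?h ` A \<longleftrightarrow> (r, c) \<in> A" if "A \<subseteq> Y" "r \<in> R" "c \<in> S" for A r c
  proof
    assume "(f r, g c) \<in> ?h ` A"
    then obtain r' c' where *: "(r', c') \<in> A" "f r = f r'" "g c = g c'" by auto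
    then have "r' \<in> R" "c' \<in> S" using that Y by auto
    with * show "(r, c) \<in> A"
      using inj_onD[OF f *(2)] inj_onD[OF g *(3)] that by simp
  qed (auto intro: rev_image_eqI)
  have char: "?h ` A \<in> tab up' lf' (g ` C) (?h ` Y) \<longleftrightarrow> A \<in> tab up lf C Y" if A: "A \<subseteq> Y" for A
  proof -
    have 1: "(\<exists>r. (r, g c) \<in> ?h ` A) \<longleftrightarrow> (\<exists>r. (r, c) \<in> A)" if "c \<in> S" for c
    proof
      assume "\<exists>r. (r, g c) \<in> ?h ` A"
      then obtain r c' where "(r, c') \<in> A" "g c' = g c" by auto
      moreover from this have "c' = c"
        using A Y g that by (auto simp: inj_on_def)
      ultimately show "\<exists>r. (r, c) \<in> A" by blast
    qed force
    have 2: "(\<exists>r'. up' r' (f r) \<and> (r', g c) \<in> ?h ` A) \<longleftrightarrow> (\<exists>r'. up r' r \<and> (r', c) \<in> A)"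
      if rc: "r \<in> R" "c \<in> S" for r c
    proof
      assume "\<exists>r'. up' r' (f r) \<and> (r', g c) \<in> ?h ` A"
      then obtain r' c' where *: "(r', c') \<in> A" "g c' = g c" "up' (f r') (f r)" by auto
      moreover from * have "r' \<in> R" "c' = c"
        using A Y g rc by (auto simp: inj_on_def)
      ultimately show "\<exists>r'. up r' r \<and> (r', c) \<in> A"
        using up rc by blast
    next
      assume "\<exists>r'. up r' r \<and> (r', c) \<in> A"
      then obtain r' where *: "up r' r" "(r', c) \<in> A" by blast
      then have "r' \<in> R" using A Y by auto
      with * show "\<exists>r'. up' r' (f r) \<and> (r', g c) \<in> ?h ` A"
        using up[OF rc(1), of r'] mem[OF A _ rc(2), of r'] by blast
    qed
    have 3: "(\<exists>c'. lf' c' (g c) \<and> (f r, c') \<in> ?h ` A) \<longleftrightarrow> (\<exists>c'. lf c' c \<and> (r, c') \<in> A)"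
      if rc: "r \<in> R" "c \<in> S" for r c
    proof
      assume "\<exists>c'. lf' c' (g c) \<and> (f r, c') \<in> ?h ` A"
      then obtain r' c' where *: "(r', c') \<in> A" "f r' = f r" "lf' (g c') (g c)" by auto
      moreover from * have "c' \<in> S" "r' = r"
        using A Y f rc by (auto simp: inj_on_def)
      ultimately show "\<exists>c'. lf c' c \<and> (r, c') \<in> A"
        using lf rc by blast
    next
      assume "\<exists>c'. lf c' c \<and> (r, c') \<in> A"
      then obtain c' where *: "lf c' c" "(r, c') \<in> A" by blast
      then have "c' \<in> S" using A Y by auto
      with * show "\<exists>c'. lf' c' (g c) \<and> (f r, c') \<in> ?h ` A"
        using lf[OF rc(2), of c'] mem[OF A rc(1), of c'] by blast
    qed
    have 4: "(\<forall>r c. (r, c) \<in> ?h ` Y \<longrightarrow> P r c) \<longleftrightarrow> (\<forall>r c. (r, c) \<in> Y \<longrightarrow> P (f r) (g c))" for P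
      by auto
    have Y': "r \<in> R" "c \<in> S" if "(r, c) \<in> Y" for r c
      using that Y by auto
    have C': "c \<in> S" if "c \<in> C" for c
      using that C by auto
    have "?h ` A \<subseteq> ?h ` Y"
      using A by auto
    then show ?thesis
      unfolding tab_def mem_Collect_eq 4 using A C' Y'
      by (simp add: 1 2 3 mem[OF A] cong: imp_cong ball_cong)
  qed
  show "tab up' lf' (g ` C) (?h ` Y) = (`) ?h ` tab up lf C Y"
  proof (intro equalityI subsetI)
    fix B assume B: "B \<in> tab up' lf' (g ` C) (?h ` Y)"
    then have "B \<subseteq> ?h ` Y"
      by (simp add: tab_def)
    then obtain A where "A \<subseteq> Y" "B = ?h ` A"
      by (auto simp: subset_image_iff)
    then show "B \<in> (`) ?h ` tab up lf C Y"
      using B char by blast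
  next
    fix B assume "B \<in> (`) ?h ` tab up lf C Y"
    then obtain A where "A \<in> tab up lf C Y" "B = ?h ` A" by blast
    moreover from this have "A \<subseteq> Y"
      by (simp add: tab_def)
    ultimately show "B \<in> tab up' lf' (g ` C) (?h ` Y)"
      using char by blast
  qed
  show "inj_on ((`) ?h) (tab up lf C Y)"
    using inj_on_image_Pow[OF inj] by (rule inj_on_subset) (auto simp: tab_def)
  show "card (?h ` A) = card A" if "A \<in> tab up lf C Y"
    using that inj by (intro card_image) (auto simp: tab_def intro: inj_on_subset)
qed

definition gf_tab :: "'a::comm_ring_1 \<Rightarrow> ('r \<times> 'c) set set \<Rightarrow> 'a" where
  "gf_tab q T = (\<Sum>A\<in>T. q ^ card A)"

text \<open>
  The three terms: a corner containing a superfluous 1; a corner containing a 0, whose row must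
  then be 0 since its column contains a 1 further up; a corner containing the only 1 of its column.
\<close>

lemma gf_tab_corner:
  assumes "finite Y" and sw: "(s, w) \<in> Y" "w \<in> C"
    and up: "\<And>r. (r, w) \<in> Y \<Longrightarrow> r = s \<or> up r s" "\<And>r. (r, w) \<in> Y \<Longrightarrow> \<not> up s r"
    and lf: "\<And>c. (s, c) \<in> Y \<Longrightarrow> c = w \<or> lf c w" "\<And>c. (s, c) \<in> Y \<Longrightarrow> \<not> lf w c"
  shows "gf_tab q (tab up lf C Y) = q * gf_tab q (tab up lf C (Y - {(s, w)}))
           + gf_tab q (tab up lf C (Y - {s} \<times> UNIV))
           + q * gf_tab q (tab up lf (C - {w}) (Y - UNIV \<times> {w}))"
proof -
  let ?x = "(s, w)"
  define T where "T = tab up lf C Y"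
  define T1 where "T1 = tab up lf C (Y - {?x})"
  define T2 where "T2 = tab up lf C (Y - {s} \<times> UNIV)"
  define T3 where "T3 = tab up lf (C - {w}) (Y - UNIV \<times> {w})"
  have s1: "{A \<in> T. ?x \<in> A \<and> (\<exists>r. r \<noteq> s \<and> (r, w) \<in> A)} = insert ?x ` T1"
  proof (intro equalityI subsetI)
    fix A assume A: "A \<in> {A \<in> T. ?x \<in> A \<and> (\<exists>r. r \<noteq> s \<and> (r, w) \<in> A)}"
    then obtain r0 where r0: "r0 \<noteq> s" "(r0, w) \<in> A" by blast
    have "A - {?x} \<in> T1"
      unfolding T1_def tab_def mem_Collect_eq
    proof (intro conjI ballI allI impI)
      fix c assume "c \<in> C"
      with A obtain r where "(r, c) \<in> A" by (auto simp: T_def tab_def)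
      then show "\<exists>r. (r, c) \<in> A - {?x}"
        using r0 by (cases "(r, c) = ?x") auto
    next
      fix r c assume "(r, c) \<in> Y - {?x}" "\<exists>r'. up r' r \<and> (r', c) \<in> A - {?x}"
        "\<exists>c'. lf c' c \<and> (r, c') \<in> A - {?x}"
      then show "(r, c) \<in> A - {?x}"
        using A unfolding T_def tab_def by blast
    qed (use A in \<open>auto simp: T_def tab_def\<close>)
    moreover have "A = insert ?x (A - {?x})"
      using A by auto
    ultimately show "A \<in> insert ?x ` T1" by blast
  next
    fix A assume "A \<in> insert ?x ` T1"
    then obtain B where B: "A = insert ?x B" "B \<in> T1" by blast
    have sub: "B \<subseteq> Y - {?x}" and col: "\<And>c. c \<in> C \<Longrightarrow> \<exists>r. (r, c) \<in> B"
      and le: "\<And>r c r' c'. (r, c) \<in> Y - {?x} \<Longrightarrow> up r' r \<Longrightarrow> (r', c) \<in> B \<Longrightarrow>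
                 lf c' c \<Longrightarrow> (r, c') \<in> B \<Longrightarrow> (r, c) \<in> B"
      using B(2) unfolding T1_def tab_def by blast+
    have "A \<in> T"
      unfolding T_def tab_def mem_Collect_eq
    proof (intro conjI ballI allI impI)
      show "A \<subseteq> Y" using sub sw B by auto
      show "\<exists>r. (r, c) \<in> A" if "c \<in> C" for c
        using col[OF that] B by auto
      fix r c assume rc: "(r, c) \<in> Y" and ex: "\<exists>r'. up r' r \<and> (r', c) \<in> A"
        "\<exists>c'. lf c' c \<and> (r, c') \<in> A"
      obtain r' c' where *: "up r' r" "(r', c) \<in> A" "lf c' c" "(r, c') \<in> A"
        using ex by blast
      \<comment> \<open>The corner is neither above nor to the left of another box, so putting a 1
        there imposes no new condition.\<close>
      have "(r', c) \<noteq> ?x" "(r, c') \<noteq> ?x"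
        using * rc up(2) lf(2) by auto
      then show "(r, c) \<in> A"
        using le[of r c r' c'] rc * B by auto
    qed
    moreover obtain r where "(r, w) \<in> B"
      using col[OF sw(2)] by blast
    ultimately show "A \<in> {A \<in> T. ?x \<in> A \<and> (\<exists>r. r \<noteq> s \<and> (r, w) \<in> A)}"
      using sub B by auto
  qed
  have s2: "{A \<in> T. ?x \<notin> A} = T2"
  proof (intro equalityI subsetI)
    fix A assume A: "A \<in> {A \<in> T. ?x \<notin> A}"
    then obtain r where r: "(r, w) \<in> A"
      using sw by (auto simp: T_def tab_def)
    have "A \<subseteq> Y"
      using A by (auto simp: T_def tab_def)
    have "up r s"
      using up(1)[of r] r A \<open>A \<subseteq> Y\<close> by auto
    have "(s, c) \<notin> A" for c
    proof
      assume c: "(s, c) \<in> A"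
      then have "lf c w"
        using lf(1)[of c] A \<open>A \<subseteq> Y\<close> by auto
      then have "?x \<in> A"
        using A sw c r \<open>up r s\<close> unfolding T_def tab_def by blast
      with A show False by simp
    qed
    then have "A \<subseteq> Y - {s} \<times> UNIV"
      using \<open>A \<subseteq> Y\<close> by auto
    then show "A \<in> T2"
      using A unfolding T2_def T_def tab_def by blast
  next
    \<comment> \<open>Restoring row s without any 1 is harmless: its boxes have no 1 to their left,
      so the condition holds vacuously there.\<close>
    fix A assume A: "A \<in> T2"
    then show "A \<in> {A \<in> T. ?x \<notin> A}"
      unfolding T2_def T_def tab_def by blast
  qed
  have s3: "{A \<in> T. ?x \<in> A \<and> \<not> (\<exists>r. r \<noteq> s \<and> (r, w) \<in> A)} = insert ?x ` T3"
  proof (intro equalityI subsetI)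
    fix A assume A: "A \<in> {A \<in> T. ?x \<in> A \<and> \<not> (\<exists>r. r \<noteq> s \<and> (r, w) \<in> A)}"
    have "A - {?x} \<in> T3"
      unfolding T3_def tab_def mem_Collect_eq
    proof (intro conjI ballI allI impI)
      show "A - {?x} \<subseteq> Y - UNIV \<times> {w}"
        using A by (auto simp: T_def tab_def)
      show "\<exists>r. (r, c) \<in> A - {?x}" if "c \<in> C - {w}" for c
        using A that by (auto simp: T_def tab_def)
      fix r c assume "(r, c) \<in> Y - UNIV \<times> {w}" "\<exists>r'. up r' r \<and> (r', c) \<in> A - {?x}"
        "\<exists>c'. lf c' c \<and> (r, c') \<in> A - {?x}"
      then show "(r, c) \<in> A - {?x}"
        using A unfolding T_def tab_def by blast
    qed
    moreover have "A = insert ?x (A - {?x})"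
      using A by auto
    ultimately show "A \<in> insert ?x ` T3" by blast
  next
    fix A assume "A \<in> insert ?x ` T3"
    then obtain B where B: "A = insert ?x B" "B \<in> T3" by blast
    have sub: "B \<subseteq> Y - UNIV \<times> {w}" and col: "\<And>c. c \<in> C - {w} \<Longrightarrow> \<exists>r. (r, c) \<in> B"
      and le: "\<And>r c r' c'. (r, c) \<in> Y - UNIV \<times> {w} \<Longrightarrow> up r' r \<Longrightarrow> (r', c) \<in> B \<Longrightarrow>
                 lf c' c \<Longrightarrow> (r, c') \<in> B \<Longrightarrow> (r, c) \<in> B"
      using B(2) unfolding T3_def tab_def by blast+
    have "A \<in> T"
      unfolding T_def tab_def mem_Collect_eq
    proof (intro conjI ballI allI impI)
      show "A \<subseteq> Y" using sub sw B by auto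
      show "\<exists>r. (r, c) \<in> A" if "c \<in> C" for c
        using col[of c] that B by (cases "c = w") auto
      fix r c assume rc: "(r, c) \<in> Y" and ex: "\<exists>r'. up r' r \<and> (r', c) \<in> A"
        "\<exists>c'. lf c' c \<and> (r, c') \<in> A"
      obtain r' c' where *: "up r' r" "(r', c) \<in> A" "lf c' c" "(r, c') \<in> A"
        using ex by blast
      have ne: "(r', c) \<noteq> ?x" "(r, c') \<noteq> ?x"
        using * rc up(2) lf(2) by auto
      \<comment> \<open>Apart from the corner, column w contains no 1 that could lie above a
        box.\<close>
      then have "c \<noteq> w"
        using * B sub by auto
      then show "(r, c) \<in> A"
        using le[of r c r' c'] rc * B ne by auto
    qed
    then show "A \<in> {A \<in> T. ?x \<in> A \<and> \<not> (\<exists>r. r \<noteq> s \<and> (r, w) \<in> A)}"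
      using sub B by auto
  qed
  have fin: "finite T" "finite T1" "finite T2" "finite T3"
    using assms(1) by (auto simp: T_def T1_def T2_def T3_def finite_tab)
  have insert: "(\<Sum>A\<in>insert ?x ` T'. q ^ card A) = q * gf_tab q T'"
    if T': "\<And>A. A \<in> T' \<Longrightarrow> A \<subseteq> Y - {?x}" for T'
  proof -
    have notin: "?x \<notin> A" "finite A" if "A \<in> T'" for A
      using T'[OF that] assms(1) by (auto intro: finite_subset)
    then have "inj_on (insert ?x) T'"
      by (auto simp: inj_on_def insert_ident)
    then show ?thesis
      using notin by (simp add: sum.reindex gf_tab_def sum_distrib_left)
  qed
  have "T = {A \<in> T. ?x \<in> A \<and> (\<exists>r. r \<noteq> s \<and> (r, w) \<in> A)} \<union> {A \<in> T. ?x \<notin> A} \<union>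
            {A \<in> T. ?x \<in> A \<and> \<not> (\<exists>r. r \<noteq> s \<and> (r, w) \<in> A)}"
    by blast
  then have T: "T = insert ?x ` T1 \<union> T2 \<union> insert ?x ` T3"
    unfolding s1 s2 s3 .
  have dis: "insert ?x ` T1 \<inter> T2 = {}" "(insert ?x ` T1 \<union> T2) \<inter> insert ?x ` T3 = {}"
    unfolding s1[symmetric] s2[symmetric] s3[symmetric] by blast+
  have "gf_tab q T =
      (\<Sum>A\<in>insert ?x ` T1. q ^ card A) + (\<Sum>A\<in>T2. q ^ card A) + (\<Sum>A\<in>insert ?x ` T3. q ^ card A)"
    unfolding gf_tab_def by (subst T) (use fin dis in \<open>simp add: sum.union_disjoint\<close>)
  also have "\<dots> = q * gf_tab q T1 + gf_tab q T2 + q * gf_tab q T3"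
  proof -
    have "A \<subseteq> Y - {?x}" if "A \<in> T1 \<or> A \<in> T3" for A
      using that by (auto simp: T1_def T3_def tab_def)
    then show ?thesis
      using insert[of T1] insert[of T3] by (simp add: gf_tab_def)
  qed
  finally show ?thesis
    unfolding T_def T1_def T2_def T3_def .
qed

text \<open>
  \<open>V\<close> is the set of labels of the boundary steps, and \<open>D\<close> the set of those labelling rows.
\<close>

definition cells :: "nat set \<Rightarrow> nat set \<Rightarrow> (nat \<times> nat) set" where
  "cells V D = {(s, w). s \<in> D \<and> w \<in> V - D \<and> s < w}"

definition label_tab :: "nat set \<Rightarrow> nat set \<Rightarrow> (nat \<times> nat) set set" where
  "label_tab V D = tab (<) (>) (V - D) (cells V D)"

lemma finite_cells: "finite V \<Longrightarrow> D \<subseteq> V \<Longrightarrow> finite (cells V D)"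
  by (rule finite_subset[of _ "V \<times> V"]) (auto simp: cells_def)

text \<open>Consecutive labels, first of a row and then of a column, bound a corner box. Removing
  the box exchanges the two steps, and removing its row or column deletes one label. The factor q of
  the last term is the 1 in the corner.\<close>

lemma gf_label_tab_swap:
  assumes "finite V" "consecutive V i i'" "E \<subseteq> V - {i, i'}"
  shows "gf_tab q (label_tab V (insert i E)) = q * gf_tab q (label_tab V (insert i' E))
           + gf_tab q (label_tab (V - {i}) E) + q * gf_tab q (label_tab (V - {i'}) (insert i E))"
proof -
  note con = consecutiveD[OF assms(2)]
  have E: "i \<notin> E" "i' \<notin> E" "E \<subseteq> V"
    using assms(3) by auto
  have gap: "x \<le> i \<or> i' \<le> x" if "x \<in> V" for x
    using assms(2) that by (auto simp: consecutive_def)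
  \<comment> \<open>Once the box is gone, its row carries label i' and its column label i;
    \<open>f\<close> and \<open>g\<close> restore the old names. Both are increasing on the labels
    concerned, as nothing lies between i and i'.\<close>
  define f g where "f = (\<lambda>x. if x = i' then i else x)" and "g = (\<lambda>x. if x = i then i' else x)"
  have gap': "x = i' \<or> x < i \<or> i' < x" if "x \<in> insert i' E" for x
    using gap[of x] that E con(1,2) by (cases "x = i") auto
  have gap'': "x = i \<or> x < i \<or> i' < x" if "x \<in> V - insert i' E" for x
    using gap[of x] that by (cases "x = i'") auto
  have less: "f x < f y \<longleftrightarrow> x < y" if "x \<in> insert i' E" "y \<in> insert i' E" for x y
    using gap'[OF that(1)] gap'[OF that(2)] con(3) by (auto simp: f_def g_def)
  have less': "g x < g y \<longleftrightarrow> x < y" if "x \<in> V - insert i' E" "y \<in> V - insert i' E" for x y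
    using gap''[OF that(1)] gap''[OF that(2)] con(3) by (auto simp: f_def g_def)
  have im: "g ` (V - insert i' E) = V - insert i E"
    using E con(1-4) by (auto simp: g_def image_iff)
  have "map_prod f g ` cells V (insert i' E) = cells V (insert i E) - {(i, i')}"
  proof (intro equalityI subsetI)
    fix x assume "x \<in> map_prod f g ` cells V (insert i' E)"
    then obtain s w where *: "x = (f s, g w)" "s \<in> insert i' E" "w \<in> V - insert i' E" "s < w"
      by (auto simp: cells_def)
    then show "x \<in> cells V (insert i E) - {(i, i')}"
      using gap[of s] gap[of w] E con(1-4) by (auto simp: cells_def f_def g_def)
  next
    fix x assume "x \<in> cells V (insert i E) - {(i, i')}"
    then obtain s w where *: "x = (s, w)" "s \<in> insert i E" "w \<in> V - insert i E" "s < w"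
      "s = i \<Longrightarrow> w \<noteq> i'"
      by (auto simp: cells_def)
    have "(if s = i then i' else s, if w = i' then i else w) \<in> cells V (insert i' E)"
      using * gap[of s] gap[of w] E con(1-4) by (auto simp: cells_def)
    moreover have "x = map_prod f g (if s = i then i' else s, if w = i' then i else w)"
      using * E con(4) by (auto simp: f_def g_def)
    ultimately show "x \<in> map_prod f g ` cells V (insert i' E)"
      by (rule rev_image_eqI)
  qed
  note cells_image = this
  have sub: "cells V (insert i' E) \<subseteq> insert i' E \<times> (V - insert i' E)"
    by (auto simp: cells_def)
  have injs: "inj_on f (insert i' E)" "inj_on g (V - insert i' E)"
    using less less' by (metis inj_onI nat_neq_iff)+
  note image = tab_image[OF sub subset_refl injs,
      where up = "(<)" and up' = "(<)" and lf = "(>)" and lf' = "(>)"]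
  have inj: "inj_on ((`) (map_prod f g)) (label_tab V (insert i' E))"
    unfolding label_tab_def by (rule image(2)) (simp_all add: less less')
  have card: "card (map_prod f g ` A) = card A" if "A \<in> label_tab V (insert i' E)" for A
    using that unfolding label_tab_def by (rule image(3)[rotated -1]) (simp_all add: less less')
  have "tab (<) (>) (g ` (V - insert i' E)) (map_prod f g ` cells V (insert i' E)) =
      (`) (map_prod f g) ` label_tab V (insert i' E)"
    unfolding label_tab_def by (rule image(1)) (simp_all add: less less')
  then
  have corner: "tab (<) (>) (V - insert i E) (cells V (insert i E) - {(i, i')}) =
      (`) (map_prod f g) ` label_tab V (insert i' E)"
    unfolding im cells_image .
  have 1: "gf_tab q (tab (<) (>) (V - insert i E) (cells V (insert i E) - {(i, i')})) =
    gf_tab q (label_tab V (insert i' E))"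
  proof -
    have "(\<Sum>A\<in>(`) (map_prod f g) ` label_tab V (insert i' E). q ^ card A) =
        (\<Sum>A\<in>label_tab V (insert i' E). q ^ card (map_prod f g ` A))"
      using sum.reindex[OF inj, of "\<lambda>A. q ^ card A"] by (simp add: o_def)
    also have "\<dots> = (\<Sum>A\<in>label_tab V (insert i' E). q ^ card A)"
      by (rule sum.cong) (simp_all add: card)
    finally show ?thesis
      unfolding corner gf_tab_def .
  qed
  have row: "cells V (insert i E) - {i} \<times> UNIV = cells (V - {i}) E" "V - insert i E = (V - {i}) - E"
    using E by (auto simp: cells_def)
  have col: "cells V (insert i E) - UNIV \<times> {i'} = cells (V - {i'}) (insert i E)"
    "V - insert i E - {i'} = V - {i'} - insert i E"
    by (auto simp: cells_def)
  have "gf_tab q (label_tab V (insert i E)) =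
      q * gf_tab q (tab (<) (>) (V - insert i E) (cells V (insert i E) - {(i, i')}))
    + gf_tab q (tab (<) (>) (V - insert i E) (cells V (insert i E) - {i} \<times> UNIV))
    + q * gf_tab q (tab (<) (>) (V - insert i E - {i'}) (cells V (insert i E) - UNIV \<times> {i'}))"
    unfolding label_tab_def
  proof (rule gf_tab_corner)
    show "finite (cells V (insert i E))"
      using assms(1) E con(1) by (intro finite_cells) auto
    show "(i, i') \<in> cells V (insert i E)" "i' \<in> V - insert i E"
      using E con(1-4) by (auto simp: cells_def)
    show "r = i \<or> r < i" if "(r, i') \<in> cells V (insert i E)" for r
      using that gap[of r] E by (auto simp: cells_def)
    then show "\<not> i < r" if "(r, i') \<in> cells V (insert i E)" for r
      using that by fastforce
    show "c = i' \<or> c > i'" if "(i, c) \<in> cells V (insert i E)" for c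
      using that gap[of c] by (auto simp: cells_def)
    then show "\<not> i' > c" if "(i, c) \<in> cells V (insert i E)" for c
      using that by fastforce
  qed
  then show ?thesis
    unfolding 1 row(1) col by (simp only: label_tab_def row(2))
qed

section \<open>Boundary values of the recursion for tableaux, and comparison of both sides\<close>

lemma label_tab_eq_empty:
  assumes "m \<in> V - D" "\<And>x. x \<in> V \<Longrightarrow> m \<le> x" "D \<subseteq> V"
  shows "label_tab V D = {}"
proof -
  \<comment> \<open>A leading horizontal step is a column without boxes, which cannot contain a
    1.\<close>
  have "\<not> s < m" if "s \<in> D" for s
    using assms(2)[of s] assms(3) that by auto
  then have "(r, m) \<notin> cells V D" for r
    by (auto simp: cells_def)
  then show ?thesis
    using assms(1) unfolding label_tab_def tab_def by blast
qed

lemma gf_label_tab_min: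
  assumes "m \<in> V - D" "\<And>x. x \<in> V \<Longrightarrow> m \<le> x" "D \<subseteq> V"
  shows "gf_tab q (label_tab V D) = 0"
  using label_tab_eq_empty[OF assms] by (simp add: gf_tab_def)

lemma gf_label_tab_all: "gf_tab q (label_tab V V) = 1"
proof -
  have "label_tab V V = {{}}"
    by (auto simp: label_tab_def tab_def cells_def)
  then show ?thesis
    by (simp add: gf_tab_def)
qed

text \<open>
  The label 0 stands for the first boundary step, which must be vertical, and \<open>Max V\<close>, which is
  never a descent bottom, has no counterpart.
\<close>

theorem gf_label_tab_eq_gf_perms:
  assumes "finite V" "V \<noteq> {}" "0 \<notin> V" "D \<subseteq> V - {Max V}"
  shows "gf_tab q (label_tab (insert 0 (V - {Max V})) (insert 0 D)) =
           q ^ (card V - 1 - card D) * gf_perms q V D"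
  using assms
\<comment> \<open>Deleting a positive label lowers the first sum without raising the second; the
  exchange keeps V and replaces w by the smaller i in the complement of D.\<close>
proof (induction "\<Sum>V + \<Sum>(V - D)" arbitrary: V D rule: less_induct)
  case less
  define M where "M = Max V"
  have M: "M \<in> V" "\<And>x. x \<in> V \<Longrightarrow> x \<le> M"
    using less.prems by (simp_all add: M_def)
  have D: "D \<subseteq> V - {M}" "finite D"
    using less.prems by (auto simp: M_def intro: finite_subset)
  have cardV: "card (V - {M}) = card V - 1"
    using M less.prems(1) by simp
  show ?case
  proof (cases "D = V - {M}")
    case True
    then show ?thesis
      using less.prems cardV
      by (simp add: M_def gf_label_tab_all gf_perms_all_bottoms)
  next
    case False
    \<comment> \<open>All labels of V below w are in D, so the step just before w is vertical, be it
      an element of D or the added 0. Thus w always ends a corner.\<close>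
    define w where "w = Min (V - {M} - D)"
    have "V - {M} - D \<noteq> {}"
      using False D by auto
    then have w: "w \<in> V" "w \<noteq> M" "w \<notin> D" "\<And>x. x \<in> V - {M} - D \<Longrightarrow> w \<le> x"
      using less.prems(1) Min_in[of "V - {M} - D"] by (auto simp: w_def)
    have "w < M" "0 < w"
      using M(2)[OF w(1)] w less.prems(3) by (auto intro: Suc_leI gr0I)
    have "card D < card (V - {M})"
      using D False less.prems(1) by (intro psubset_card_mono) auto
    then have t: "card V - 1 - card D = Suc (card V - 2 - card D)"
      using cardV by simp
    \<comment> \<open>This factor belongs to column w and meets the q before the third term of the
      tableau recursion.\<close>
    then have qt: "q ^ (card V - 1 - card D) = q * q ^ (card V - 2 - card D)"
      by (metis power_Suc)
    have Maxw: "Max (V - {w}) = M"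
      using M w less.prems(1) by (intro Max_eqI) auto
    have IHw: "gf_tab q (label_tab (insert 0 (V - {w} - {M})) (insert 0 D)) =
        q ^ (card V - 2 - card D) * gf_perms q (V - {w}) D"
    proof -
      have "\<Sum>(V - {w}) < \<Sum>V"
        using less.prems(1) w(1) \<open>0 < w\<close> by (simp add: sum.remove[of V w])
      moreover have "\<Sum>(V - {w} - D) \<le> \<Sum>(V - D)"
        using less.prems(1) by (intro sum_mono2) auto
      ultimately have "gf_tab q (label_tab (insert 0 (V - {w} - {Max (V - {w})})) (insert 0 D)) =
        q ^ (card (V - {w}) - 1 - card D) * gf_perms q (V - {w}) D"
        using less.prems D M w Maxw by (intro less.hyps) auto
      moreover have "card (V - {w}) - 1 - card D = card V - 2 - card D"
        using w(1) less.prems(1) by simp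
      ultimately show ?thesis
        unfolding Maxw by simp
    qed
    define W0 where "W0 = insert 0 (V - {M})"
    have W0: "W0 - {w} = insert 0 (V - {w} - {M})"
      using \<open>0 < w\<close> by (auto simp: W0_def)
    have "finite W0"
      using less.prems(1) by (simp add: W0_def)
    show ?thesis
    proof (cases "\<forall>x\<in>V. w \<le> x")
      case True
      \<comment> \<open>The corner lies in the top row. Exchanging its steps or deleting the row
        would make the first step horizontal, so only the deletion of the column survives; it
        corresponds to deleting the minimal letter w.\<close>
      have con: "consecutive W0 0 w"
        using True w \<open>0 < w\<close> by (auto simp: W0_def consecutive_def)
      have sub: "D \<subseteq> W0 - {0, w}"
        using D w less.prems(3) by (auto simp: W0_def)
      have "gf_tab q (label_tab W0 (insert w D)) = 0"
        by (rule gf_label_tab_min[of 0]) (use less.prems(3) D w \<open>0 < w\<close> in \<open>auto simp: W0_def\<close>)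
      moreover have "gf_tab q (label_tab (W0 - {0}) D) = 0"
        by (rule gf_label_tab_min[of w])
           (use less.prems(3) D w True \<open>0 < w\<close> in \<open>auto simp: W0_def\<close>)
      moreover have "gf_perms q V D = gf_perms q (V - {w}) D"
        by (rule gf_perms_remove_min) (use less.prems(1) D w True M in auto)
      ultimately show ?thesis
        using gf_label_tab_swap[OF \<open>finite W0\<close> con sub, of q]
        unfolding W0 IHw qt M_def[symmetric] W0_def[symmetric] by (simp add: mult.assoc)
    next
      case False
      define i where "i = Max {x \<in> V. x < w}"
      have "{x \<in> V. x < w} \<noteq> {}" "finite {x \<in> V. x < w}"
        using False less.prems(1) by (auto simp: not_le)
      then have i: "i \<in> V" "i < w" "\<And>x. x \<in> V \<Longrightarrow> x < w \<Longrightarrow> x \<le> i"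
        using Max_in[of "{x \<in> V. x < w}"] by (auto simp: i_def)
      have "i \<in> D" "i \<noteq> M" "0 < i"
        using w(4)[of i] i \<open>w < M\<close> less.prems(3) by (auto intro: gr0I)
      define E where "E = D - {i}"
      have DE: "D = insert i E"
        using \<open>i \<in> D\<close> by (auto simp: E_def)
      have con: "consecutive V i w"
        using i w by (auto simp: consecutive_def not_less[symmetric])
      then have con0: "consecutive W0 i w"
        using \<open>i \<noteq> M\<close> w(2) by (auto simp: W0_def consecutive_def)
      have subE: "E \<subseteq> V - {i, w}"
        using D w by (auto simp: E_def)
      have subE0: "insert 0 E \<subseteq> W0 - {i, w}"
        using D w \<open>0 < i\<close> \<open>0 < w\<close> by (auto simp: E_def W0_def)
      have cardD: "card (insert w E) = card D" "card E = card D - 1" "card D > 0"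
      proof -
        show "card D > 0"
          using D(2) \<open>i \<in> D\<close> by (auto simp: card_gt_0_iff)
        then show "card (insert w E) = card D" "card E = card D - 1"
          using D(2) w(3) \<open>i \<in> D\<close> by (simp_all add: E_def)
      qed
      have IH1: "gf_tab q (label_tab W0 (insert 0 (insert w E))) =
          q ^ (card V - 1 - card D) * gf_perms q V (insert w E)"
      proof -
        have "V - insert w E = insert i (V - D - {w})" "i \<notin> V - D - {w}" "w \<in> V - D"
          using i w \<open>i \<in> D\<close> by (auto simp: E_def)
        then have "\<Sum>(V - insert w E) < \<Sum>(V - D)"
          using less.prems(1) i(2) by (simp add: sum.remove[of "V - D" w])
        then have "gf_tab q (label_tab (insert 0 (V - {Max V})) (insert 0 (insert w E))) =
          q ^ (card V - 1 - card (insert w E)) * gf_perms q V (insert w E)"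
          using less.prems D w by (intro less.hyps) (auto simp: M_def E_def)
        then show ?thesis
          by (simp only: cardD W0_def M_def)
      qed
      have IH2: "gf_tab q (label_tab (W0 - {i}) (insert 0 E)) =
          q ^ (card V - 1 - card D) * gf_perms q (V - {i}) E"
      proof -
        have Maxi: "Max (V - {i}) = M"
          using M \<open>i \<noteq> M\<close> less.prems(1) by (intro Max_eqI) auto
        have "\<Sum>(V - {i}) < \<Sum>V"
          using less.prems(1) i(1) \<open>0 < i\<close> by (simp add: sum.remove[of V i])
        moreover have "V - {i} - E = V - D"
          by (auto simp: DE)
        ultimately have "gf_tab q (label_tab (insert 0 (V - {i} - {Max (V - {i})})) (insert 0 E)) =
          q ^ (card (V - {i}) - 1 - card E) * gf_perms q (V - {i}) E"
          using less.prems D w \<open>i \<noteq> M\<close> M Maxi by (intro less.hyps) (auto simp: E_def)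
        moreover have "card (V - {i}) - 1 - card E = card V - 1 - card D"
          using cardD i(1) less.prems(1) by simp
        moreover have "W0 - {i} = insert 0 (V - {i} - {M})"
          using \<open>0 < i\<close> by (auto simp: W0_def)
        ultimately show ?thesis
          unfolding Maxi by simp
      qed
      have "gf_tab q (label_tab W0 (insert 0 D)) =
          q * gf_tab q (label_tab W0 (insert 0 (insert w E)))
          + gf_tab q (label_tab (W0 - {i}) (insert 0 E))
          + q * gf_tab q (label_tab (W0 - {w}) (insert 0 D))"
        using gf_label_tab_swap[OF \<open>finite W0\<close> con0 subE0, of q]
        unfolding DE by (simp only: insert_commute[of _ 0])
      also have "\<dots> = q ^ (card V - 1 - card D) *
          (q * gf_perms q V (insert w E) + gf_perms q (V - {i}) E + gf_perms q (V - {w}) D)"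
        unfolding IH1 IH2 W0 IHw qt by (simp add: algebra_simps)
      also have "\<dots> = q ^ (card V - 1 - card D) * gf_perms q V D"
        using gf_perms_swap[OF less.prems(1) con subE, of q] by (simp add: DE)
      finally show ?thesis
        by (simp add: W0_def M_def)
    qed
  qed
qed

section \<open>Shapes as sets of row labels\<close>

lemma partitions_in_rectangleD:
  assumes "lam \<in> partitions_in_rectangle k m"
  shows "length lam = k" "i < k \<Longrightarrow> lam ! i \<le> m" "i \<le> i' \<Longrightarrow> i' < k \<Longrightarrow> lam ! i' \<le> lam ! i"
proof -
  show len: "length lam = k" and "i < k \<Longrightarrow> lam ! i \<le> m"
    using assms by (auto simp: partitions_in_rectangle_def)
  show "lam ! i' \<le> lam ! i" if "i \<le> i'" "i' < k"
  proof (cases "i = i'")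
    case False
    have "sorted_wrt (\<ge>) lam"
      using assms by (simp add: partitions_in_rectangle_def)
    from sorted_wrt_nth_less[OF this, of i i'] show ?thesis
      using that False len by simp
  qed simp
qed

text \<open>
  The label of a row or column is the number of boundary steps before it: for row \<open>i\<close>, these are
  \<open>i\<close> rows and \<open>m - lam ! i\<close> columns; for column \<open>j\<close>, the columns to its right and the rows that
  it meets.
\<close>

definition row_label :: "nat \<Rightarrow> nat list \<Rightarrow> nat \<Rightarrow> nat" where
  "row_label m lam i = i + m - lam ! i"

definition col_label :: "nat \<Rightarrow> nat list \<Rightarrow> nat \<Rightarrow> nat" where
  "col_label m lam j = m - Suc j + card {i. i < length lam \<and> j < lam ! i}"

definition row_labels :: "nat \<Rightarrow> nat list \<Rightarrow> nat set" where
  "row_labels m lam = row_label m lam ` {..<length lam}"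

context
  fixes k m :: nat and lam :: "nat list"
  assumes lam: "lam \<in> partitions_in_rectangle k m"
begin

lemmas lamD = partitions_in_rectangleD[OF lam]

lemma row_label_mono: "i < i' \<Longrightarrow> i' < k \<Longrightarrow> row_label m lam i < row_label m lam i'"
  using lamD(2)[of i] lamD(2)[of i'] lamD(3)[of i i'] by (simp add: row_label_def)

lemma row_label_less_iff:
  "i < k \<Longrightarrow> i' < k \<Longrightarrow> row_label m lam i < row_label m lam i' \<longleftrightarrow> i < i'"
  using row_label_mono[of i i'] row_label_mono[of i' i] by (cases i i' rule: linorder_cases) auto

lemma col_label_antimono:
  assumes "j < j'" "j' < m"
  shows "col_label m lam j' < col_label m lam j"
proof -
  have "card {i. i < length lam \<and> j' < lam ! i} \<le> card {i. i < length lam \<and> j < lam ! i}"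
    using assms by (intro card_mono) auto
  then show ?thesis
    using assms by (simp add: col_label_def)
qed

lemma col_label_less_iff:
  "j < m \<Longrightarrow> j' < m \<Longrightarrow> col_label m lam j < col_label m lam j' \<longleftrightarrow> j' < j"
  using col_label_antimono[of j j'] col_label_antimono[of j' j]
  by (cases j j' rule: linorder_cases) auto

text \<open>A row and a column meet in a box exactly if the step of the row comes first on the
  boundary. If box (i, j) exists, the rows 0 to i all reach column j; if not, only rows above i
  can.\<close>

lemma row_label_vs_col_label:
  assumes "i < k" "j < m"
  shows "j < lam ! i \<Longrightarrow> row_label m lam i < col_label m lam j"
    and "\<not> j < lam ! i \<Longrightarrow> col_label m lam j < row_label m lam i"
proof -
  let ?S = "{i'. i' < length lam \<and> j < lam ! i'}"
  show "row_label m lam i < col_label m lam j" if "j < lam ! i"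
  proof -
    have "{..i} \<subseteq> ?S"
      using that lamD(1) lamD(3)[of _ i] assms by (auto intro: less_le_trans)
    then have "card {..i} \<le> card ?S"
      by (intro card_mono) auto
    then show ?thesis
      using that lamD(2)[OF assms(1)] assms by (simp add: row_label_def col_label_def)
  qed
  show "col_label m lam j < row_label m lam i" if "\<not> j < lam ! i"
  proof -
    have "?S \<subseteq> {..<i}"
    proof
      fix i' assume "i' \<in> ?S"
      then show "i' \<in> {..<i}"
        using that lamD(1) lamD(3)[of i i'] by (cases "i' < i") auto
    qed
    then have "card ?S \<le> card {..<i}"
      by (intro card_mono) auto
    then show ?thesis
      using that lamD(2)[OF assms(1)] assms by (simp add: row_label_def col_label_def)
  qed
qed

lemma inj_row_label: "inj_on (row_label m lam) {..<k}"
  using row_label_less_iff by (intro inj_onI) (metis lessThan_iff nat_neq_iff)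

lemma inj_col_label: "inj_on (col_label m lam) {..<m}"
  using col_label_less_iff by (intro inj_onI) (metis lessThan_iff nat_neq_iff)

lemma row_labels_subset: "row_labels m lam \<subseteq> {..<k + m}"
  using lamD(1) by (auto simp: row_labels_def row_label_def)

lemma card_row_labels: "card (row_labels m lam) = k"
  using inj_row_label lamD(1) by (simp add: row_labels_def card_image)

text \<open>No column label is a row label, and both sides have m elements by injectivity, so the
  inclusion is an equality.\<close>

lemma col_labels: "col_label m lam ` {..<m} = {..<k + m} - row_labels m lam"
proof (rule card_seteq)
  show "col_label m lam ` {..<m} \<subseteq> {..<k + m} - row_labels m lam"
  proof
    fix x assume "x \<in> col_label m lam ` {..<m}"
    then obtain j where j: "x = col_label m lam j" "j < m" by auto
    have "card {i. i < length lam \<and> j < lam ! i} \<le> card {..<k}"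
      using lamD(1) by (intro card_mono) auto
    then have "x < k + m"
      using j by (simp add: col_label_def)
    moreover have "x \<noteq> row_label m lam i" if "i < k" for i
      using row_label_vs_col_label[OF that j(2)] j(1) by (cases "j < lam ! i") auto
    ultimately show "x \<in> {..<k + m} - row_labels m lam"
      using lamD(1) by (auto simp: row_labels_def)
  qed
  have "card ({..<k + m} - row_labels m lam) = m"
    using row_labels_subset card_row_labels by (simp add: card_Diff_subset finite_subset)
  then show "card ({..<k + m} - row_labels m lam) \<le> card (col_label m lam ` {..<m})"
    using inj_col_label by (simp add: card_image)
qed simp

lemma young_diagram_subset: "young_diagram lam \<subseteq> {..<k} \<times> {..<m}"
  using lamD(1,2) by (auto simp: young_diagram_def intro: less_le_trans)

lemma cells_row_labels:
  "cells {..<k + m} (row_labels m lam) =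
     map_prod (row_label m lam) (col_label m lam) ` young_diagram lam"
proof (intro equalityI subsetI)
  fix x assume "x \<in> cells {..<k + m} (row_labels m lam)"
  then obtain i j where *: "x = (row_label m lam i, col_label m lam j)" "i < k" "j < m"
    "row_label m lam i < col_label m lam j"
    unfolding cells_def col_labels[symmetric] using lamD(1) by (auto simp: row_labels_def)
  then have "(i, j) \<in> young_diagram lam"
    using row_label_vs_col_label(2)[of i j] lamD(1) by (auto simp: young_diagram_def)
  with * show "x \<in> map_prod (row_label m lam) (col_label m lam) ` young_diagram lam"
    by force
next
  fix x assume "x \<in> map_prod (row_label m lam) (col_label m lam) ` young_diagram lam"
  then obtain i j where *: "x = (row_label m lam i, col_label m lam j)" "(i, j) \<in> young_diagram lam"
    by auto
  then have ij: "i < k" "j < m" "j < lam ! i"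
    using young_diagram_subset by (auto simp: young_diagram_def)
  then show "x \<in> cells {..<k + m} (row_labels m lam)"
    unfolding cells_def col_labels[symmetric]
    using * row_label_vs_col_label(1)[OF ij] lamD(1) by (auto simp: row_labels_def)
qed

lemma card_cells_row_labels: "card (cells {..<k + m} (row_labels m lam)) = card (young_diagram lam)"
  unfolding cells_row_labels
  using map_prod_inj_on[OF inj_row_label inj_col_label] young_diagram_subset
  by (intro card_image) (rule inj_on_subset)

lemma card_label_tab_row_labels:
  "card {A \<in> label_tab {..<k + m} (row_labels m lam). card A = b} =
   card {A \<in> tab (<) (<) {..<m} (young_diagram lam). card A = b}"
proof -
  let ?h = "map_prod (row_label m lam) (col_label m lam)"
  let ?T = "tab (<) (<) {..<m} (young_diagram lam)"
  note image = tab_image[OF young_diagram_subset subset_refl inj_row_label inj_col_label,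
      where up = "(<)" and up' = "(<)" and lf = "(<)" and lf' = "(>)"]
  have eq: "label_tab {..<k + m} (row_labels m lam) = (`) ?h ` ?T"
    unfolding label_tab_def cells_row_labels col_labels[symmetric]
    by (rule image(1)) (simp_all add: row_label_less_iff col_label_less_iff)
  have inj: "inj_on ((`) ?h) ?T"
    by (rule image(2)) (simp_all add: row_label_less_iff col_label_less_iff)
  have card: "card (?h ` A) = card A" if "A \<in> ?T" for A
    using that by (rule image(3)[rotated -1]) (simp_all add: row_label_less_iff col_label_less_iff)
  have "{A \<in> label_tab {..<k + m} (row_labels m lam). card A = b} = (`) ?h ` {A \<in> ?T. card A = b}"
    unfolding eq using card by auto
  then show ?thesis
    using inj by (simp add: card_image inj_on_subset)
qed

text \<open>The shape fixes the number of 2's. Under the two numerical assumptions, prescribing the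
  number of 1's therefore also settles the numbers of 0's and 2's.\<close>

lemma bij_betw_fillings:
  assumes "a + b + c = k * m" "card (young_diagram lam) + c = k * m"
  shows "bij_betw (\<lambda>F. {x \<in> {..<k} \<times> {..<m}. F x = (1::nat)})
           {F. (lam, F) \<in> tableaux_T (k + m) k a b c}
           {A \<in> tab (<) (<) {..<m} (young_diagram lam). card A = b}"
    (is "bij_betw ?ones ?S ?T")
proof (rule bij_betw_byWitness[where f' = "\<lambda>A x. if x \<in> A then 1 else if x \<in> young_diagram lam then 0
      else if x \<in> {..<k} \<times> {..<m} then 2 else undefined"])
  let ?f' = "\<lambda>A x. if x \<in> A then 1 else if x \<in> young_diagram lam then 0
      else if x \<in> {..<k} \<times> {..<m} then 2 else undefined :: nat"
  have S: "(\<forall>x\<in>young_diagram lam. F x \<in> {0, 1}) \<and> F \<in> extensional ({..<k} \<times> {..<m})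
      \<and> (\<forall>x\<in>{..<k} \<times> {..<m} - young_diagram lam. F x = 2)" if "F \<in> ?S" for F
    using that by (auto simp: tableaux_T_def permutation_tableaux_def)
  show "\<forall>F\<in>?S. ?f' (?ones F) = F"
  proof (intro ballI ext)
    fix F x assume F: "F \<in> ?S"
    show "?f' (?ones F) x = F x"
      using S[OF F] young_diagram_subset by (cases x) (auto simp: extensional_def)
  qed
  show "\<forall>A\<in>?T. ?ones (?f' A) = A"
    using young_diagram_subset by (auto simp: tab_def split: if_splits)
  show "?ones ` ?S \<subseteq> ?T"
  proof (rule image_subsetI)
    fix F assume F: "F \<in> ?S"
    have T: "\<forall>j<m. \<exists>i<k. F (i, j) = 1" "card (?ones F) = b"
      and le: "\<not> (\<exists>(i, j)\<in>young_diagram lam. F (i, j) = 0 \<and>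
             (\<exists>i'<i. F (i', j) = 1) \<and> (\<exists>j'<j. F (i, j') = 1))"
      using F by (auto simp: tableaux_T_def permutation_tableaux_def num_entries_def)
    have "?ones F \<subseteq> young_diagram lam"
    proof
      fix x assume "x \<in> ?ones F"
      then show "x \<in> young_diagram lam"
        using S[OF F] by (cases "x \<in> young_diagram lam") auto
    qed
    moreover have "(i, j) \<in> ?ones F" if "(i, j) \<in> young_diagram lam" "i' < i" "(i', j) \<in> ?ones F"
      "j' < j" "(i, j') \<in> ?ones F" for i j i' j'
      using that le S[OF F] young_diagram_subset by fastforce
    ultimately show "?ones F \<in> ?T"
      using T unfolding tab_def by fastforce
  qed
  show "?f' ` ?T \<subseteq> ?S"
  proof (rule image_subsetI)
    fix A assume A: "A \<in> ?T"
    have sub: "A \<subseteq> young_diagram lam" and cardA: "card A = b"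
      using A by (auto simp: tab_def)
    have fin: "finite (young_diagram lam)"
      using young_diagram_subset by (rule finite_subset) simp
    have "num_entries k m (?f' A) 1 = card A"
      unfolding num_entries_def using sub young_diagram_subset
      by (intro arg_cong[where f = card]) auto
    moreover have "num_entries k m (?f' A) 0 = card (young_diagram lam - A)"
      unfolding num_entries_def using sub young_diagram_subset
      by (intro arg_cong[where f = card]) auto
    moreover have "card (young_diagram lam - A) + card A = card (young_diagram lam)"
      using sub fin by (metis card_Diff_subset card_mono finite_subset le_add_diff_inverse2)
    moreover have "num_entries k m (?f' A) 2 = card ({..<k} \<times> {..<m} - young_diagram lam)"
      unfolding num_entries_def using sub young_diagram_subset
      by (intro arg_cong[where f = card]) auto
    moreover have "card ({..<k} \<times> {..<m} - young_diagram lam) + card (young_diagram lam) = k * m"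
      using young_diagram_subset fin card_mono[OF _ young_diagram_subset]
      by (simp add: card_Diff_subset card_cartesian_product)
    ultimately have num: "num_entries k m (?f' A) 0 = a" "num_entries k m (?f' A) 1 = b"
      "num_entries k m (?f' A) 2 = c"
      using assms cardA by linarith+
    have col: "\<exists>i<k. ?f' A (i, j) = 1" if j: "j < m" for j
    proof -
      obtain i where "(i, j) \<in> A"
        using A j unfolding tab_def by blast
      then show ?thesis
        using sub young_diagram_subset by (intro exI[of _ i]) auto
    qed
    have one: "x \<in> A" if "?f' A x = 1" "x \<in> {..<k} \<times> {..<m}" for x
      using that by (auto split: if_splits)
    have le: False if "(i, j) \<in> young_diagram lam" "?f' A (i, j) = 0" "i' < i" "?f' A (i', j) = 1"
      "j' < j" "?f' A (i, j') = 1" for i j i' j'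
    proof -
      have "i < k" "j < m"
        using that young_diagram_subset by auto
      then have "(i', j) \<in> A" "(i, j') \<in> A"
        using one[OF that(4)] one[OF that(6)] that(3,5) by auto
      then have "(i, j) \<in> A"
        using A that unfolding tab_def by blast
      then show False
        using that(2) by simp
    qed
    have "(lam, ?f' A) \<in> permutation_tableaux k m"
      unfolding permutation_tableaux_def mem_Collect_eq case_prod_conv
    proof (intro conjI)
      show "\<not> (\<exists>(i, j)\<in>young_diagram lam. ?f' A (i, j) = 0 \<and>
             (\<exists>i'<i. ?f' A (i', j) = 1) \<and> (\<exists>j'<j. ?f' A (i, j') = 1))"
        using le by blast
      show "\<forall>j<m. \<exists>i<k. ?f' A (i, j) = 1"
        using col by blast
    qed (use lam sub young_diagram_subset in \<open>auto simp: extensional_def\<close>)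
    then show "?f' A \<in> ?S"
      using num by (simp add: tableaux_T_def)
  qed
qed

text \<open>Complements the bijection above: if its numerical assumptions fail for a shape, no
  tableau of that shape is counted.\<close>

lemma num_entries_tableaux:
  assumes "(lam, F) \<in> tableaux_T (k + m) k a b c"
  shows "a + b + c = k * m" "card (young_diagram lam) + c = k * m"
proof -
  let ?R = "{..<k} \<times> {..<m}"
  have F: "\<And>x. x \<in> young_diagram lam \<Longrightarrow> F x = 0 \<or> F x = 1"
    "\<And>x. x \<in> ?R - young_diagram lam \<Longrightarrow> F x = 2"
    and num: "a = card {x \<in> ?R. F x = 0}" "b = card {x \<in> ?R. F x = 1}" "c = card {x \<in> ?R. F x = 2}"
    using assms by (auto simp: tableaux_T_def permutation_tableaux_def num_entries_def)
  have fin: "finite (young_diagram lam)"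
    using young_diagram_subset by (rule finite_subset) simp
  have "{x \<in> ?R. F x = 2} = ?R - young_diagram lam"
    using F by fastforce
  then have c: "card (young_diagram lam) + c = k * m"
    using young_diagram_subset fin card_mono[OF _ young_diagram_subset] num(3)
    by (simp add: card_Diff_subset card_cartesian_product)
  have "young_diagram lam = {x \<in> ?R. F x = 0} \<union> {x \<in> ?R. F x = 1}"
    using F young_diagram_subset by fastforce
  then have "card (young_diagram lam) = a + b"
    using card_Un_disjoint[of "{x \<in> ?R. F x = 0}" "{x \<in> ?R. F x = 1}"] num(1,2) by fastforce
  with c show "a + b + c = k * m" "card (young_diagram lam) + c = k * m"
    by simp_all
qed

end

section \<open>Shapes correspond to sets of row labels\<close>

lemma bij_betw_row_labels:
  "bij_betw (row_labels m) (partitions_in_rectangle k m) {D. D \<subseteq> {..<k + m} \<and> card D = k}"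
  unfolding bij_betw_def
proof (intro conjI equalityI subsetI)
  \<comment> \<open>Labels increase from row to row, so sorting the set recovers the label of each
    row and hence its length.\<close>
  have sorted_labels: "map (row_label m lam) [0..<k] = sorted_list_of_set (row_labels m lam)"
    if lam: "lam \<in> partitions_in_rectangle k m" for lam
  proof (rule sorted_list_of_set.idem_if_sorted_distinct[symmetric, THEN trans])
    show "sorted_list_of_set (set (map (row_label m lam) [0..<k])) =
        sorted_list_of_set (row_labels m lam)"
      using partitions_in_rectangleD(1)[OF lam] by (simp add: row_labels_def atLeast0LessThan)
  qed (use row_label_mono[OF lam] inj_row_label[OF lam] in
      \<open>auto simp: sorted_iff_nth_mono distinct_map atLeast0LessThan le_less\<close>)
  show "inj_on (row_labels m) (partitions_in_rectangle k m)"
  proof (rule inj_onI)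
    fix lam lam'
    assume lam: "lam \<in> partitions_in_rectangle k m" and lam': "lam' \<in> partitions_in_rectangle k m"
      and "row_labels m lam = row_labels m lam'"
    then have "map (row_label m lam) [0..<k] = map (row_label m lam') [0..<k]"
      by (simp add: sorted_labels)
    then have eq: "row_label m lam i = row_label m lam' i" if "i < k" for i
      using that by simp
    show "lam = lam'"
    proof (rule nth_equalityI)
      fix i assume "i < length lam"
      then have "i < k"
        using partitions_in_rectangleD(1)[OF lam] by simp
      then show "lam ! i = lam' ! i"
        using eq[of i] partitions_in_rectangleD(2)[OF lam] partitions_in_rectangleD(2)[OF lam']
        by (auto simp: row_label_def) (metis diff_diff_cancel diff_le_self le_add2 le_trans)
    qed (simp add: partitions_in_rectangleD(1)[OF lam] partitions_in_rectangleD(1)[OF lam'])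
  qed
next
  fix D assume "D \<in> row_labels m ` partitions_in_rectangle k m"
  then show "D \<in> {D. D \<subseteq> {..<k + m} \<and> card D = k}"
    using row_labels_subset card_row_labels by blast
next
  fix D assume "D \<in> {D. D \<subseteq> {..<k + m} \<and> card D = k}"
  then have D: "D \<subseteq> {..<k + m}" "card D = k" and "finite D"
    by (auto intro: finite_subset)
  define s where "s = sorted_list_of_set D"
  have s: "length s = k" "set s = D" "sorted_wrt (<) s"
    using D \<open>finite D\<close> by (simp_all add: s_def)
  have less: "s ! i < s ! j" if "i < j" "j < k" for i j
    using sorted_wrt_nth_less[OF s(3) that(1)] that(2) s(1) by simp
  \<comment> \<open>The differences \<open>s ! i - i\<close> increase weakly: this makes the row
    lengths below decrease weakly and also gives their bounds.\<close>
  have grow: "s ! i + d \<le> s ! (i + d)" if "i + d < k" for i d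
    using that
  proof (induction d)
    case (Suc d)
    then show ?case
      using less[of "i + d" "i + Suc d"] by simp
  qed simp
  have bounds: "i \<le> s ! i" "s ! i \<le> m + i" if "i < k" for i
  proof -
    show "i \<le> s ! i"
      using grow[of 0 i] that by simp
    have "s ! (k - 1) < k + m"
      using s(1,2) D(1) that
      by (metis diff_less lessThan_iff less_nat_zero_code neq0_conv nth_mem subsetD zero_less_one)
    then show "s ! i \<le> m + i"
      using grow[of i "k - 1 - i"] that by simp
  qed
  \<comment> \<open>The defining equation of \<open>row_label\<close> solved for the row
    length.\<close>
  define lam where "lam = map (\<lambda>i. m + i - s ! i) [0..<k]"
  have nth: "lam ! i = m + i - s ! i" if "i < k" for i
    using that by (simp add: lam_def)
  have "lam ! j \<le> lam ! i" if "i < j" "j < k" for i j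
    using grow[of i "j - i"] that nth[of i] nth[of j] by simp
  then have "sorted_wrt (\<ge>) lam"
    unfolding sorted_wrt_iff_nth_less by (simp add: lam_def)
  moreover have "x \<le> m" if "x \<in> set lam" for x
  proof -
    obtain i where "i < k" "x = m + i - s ! i"
      using \<open>x \<in> set lam\<close> by (auto simp: lam_def)
    then show ?thesis
      using bounds(1)[of i] by simp
  qed
  ultimately have "lam \<in> partitions_in_rectangle k m"
    by (simp add: partitions_in_rectangle_def lam_def)
  moreover have "row_labels m lam = D"
  proof -
    have "row_label m lam i = s ! i" if "i < k" for i
      using bounds[OF that] nth[OF that] by (simp add: row_label_def)
    then have "row_labels m lam = (!) s ` {..<k}"
      by (auto simp: row_labels_def lam_def intro!: image_cong)
    also have "\<dots> = D"
      using s by (auto simp: in_set_conv_nth)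
    finally show ?thesis .
  qed
  ultimately show "D \<in> row_labels m ` partitions_in_rectangle k m"
    by blast
qed

lemma card_tableaux_T:
  "card (tableaux_T (k + m) k a b c) =
     (\<Sum>D | D \<subseteq> {..<k + m} \<and> card D = k.
        if a + b + c = k * m \<and> card (cells {..<k + m} D) + c = k * m
        then card {A \<in> label_tab {..<k + m} D. card A = b} else 0)"
proof -
  let ?P = "partitions_in_rectangle k m"
  let ?F = "\<lambda>lam. {F. (lam, F) \<in> tableaux_T (k + m) k a b c}"
  define h where "h D = (if a + b + c = k * m \<and> card (cells {..<k + m} D) + c = k * m
        then card {A \<in> label_tab {..<k + m} D. card A = b} else 0)" for D
  have "finite {D. D \<subseteq> {..<k + m} \<and> card D = k}"
    by (rule finite_subset[of _ "Pow {..<k + m}"]) auto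
  then have finP: "finite ?P"
    using bij_betw_finite[OF bij_betw_row_labels] by blast
  have F: "finite (?F lam) \<and> card (?F lam) = h (row_labels m lam)" if lam: "lam \<in> ?P" for lam
  proof (cases "a + b + c = k * m \<and> card (young_diagram lam) + c = k * m")
    case True
    have "finite (young_diagram lam)"
      using young_diagram_subset[OF lam] by (rule finite_subset) simp
    then have "finite {A \<in> tab (<) (<) {..<m} (young_diagram lam). card A = b}"
      by (simp add: finite_tab)
    moreover note bij = bij_betw_fillings[OF lam, of a b c]
    ultimately show ?thesis
      using True bij_betw_finite[OF bij] bij_betw_same_card[OF bij]
      by (simp add: h_def card_cells_row_labels[OF lam] card_label_tab_row_labels[OF lam])
  next
    case False
    then have "?F lam = {}"
      using num_entries_tableaux[OF lam] by blast
    then show ?thesis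
      using False by (simp add: h_def card_cells_row_labels[OF lam]) blast
  qed
  have "tableaux_T (k + m) k a b c = Sigma ?P ?F"
    by (auto simp: tableaux_T_def permutation_tableaux_def)
  then have "card (tableaux_T (k + m) k a b c) = card (Sigma ?P ?F)"
    by (rule arg_cong)
  also have "\<dots> = (\<Sum>lam\<in>?P. h (row_labels m lam))"
    using finP F by simp
  also have "\<dots> = (\<Sum>D | D \<subseteq> {..<k + m} \<and> card D = k. h D)"
    by (rule sum.reindex_bij_betw[OF bij_betw_row_labels])
  finally show ?thesis
    by (simp add: h_def)
qed

section \<open>The number of boxes in terms of the row labels\<close>

lemma card_pairs_less: "finite X \<Longrightarrow> card {(s, w). s \<in> X \<and> w \<in> X \<and> w < (s::nat)} = card X choose 2"
proof (induction X rule: finite_linorder_max_induct)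
  case (insert x X)
  have "{(s, w). s \<in> insert x X \<and> w \<in> insert x X \<and> w < s} =
      {(s, w). s \<in> X \<and> w \<in> X \<and> w < s} \<union> {x} \<times> X"
    using insert.hyps by auto
  moreover have "finite {(s, w). s \<in> X \<and> w \<in> X \<and> w < s}"
    by (rule finite_subset[of _ "X \<times> X"]) (use insert.hyps in auto)
  moreover have "{(s, w). s \<in> X \<and> w \<in> X \<and> w < s} \<inter> {x} \<times> X = {}" "x \<notin> X"
    using insert.hyps by auto
  ultimately show ?case
    using insert by (simp add: card_Un_disjoint card_cartesian_product numeral_2_eq_2)
qed simp

text \<open>A label s in X exceeds exactly s labels. Those outside X complete the boxes to all pairs
  of a row and a column; those inside X form the pairs counted by the binomial.\<close>

lemma card_cells_plus_sum:
  assumes "X \<subseteq> {..<n}"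
  shows "card (cells {..<n} X) + \<Sum>X = card X * (n - card X) + (card X choose 2)"
proof -
  have fin: "finite X"
    using assms by (rule finite_subset) simp
  define I where "I = {(s, w). s \<in> X \<and> w \<in> {..<n} - X \<and> w < s}"
  define J where "J = {(s, w). s \<in> X \<and> w \<in> X \<and> w < s}"
  have finIJ: "finite I" "finite J" "finite (cells {..<n} X)"
    by (rule finite_subset[of _ "{..<n} \<times> {..<n}"], use assms in \<open>auto simp: I_def J_def cells_def\<close>)+
  have "cells {..<n} X \<union> I = X \<times> ({..<n} - X)" "cells {..<n} X \<inter> I = {}"
    by (auto simp: cells_def I_def) (metis nat_neq_iff)
  then have "card (cells {..<n} X) + card I = card X * (n - card X)"
    using finIJ fin assms
    by (metis card_Diff_subset card_Un_disjoint card_cartesian_product card_lessThan)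
  moreover have "I \<union> J = (SIGMA s:X. {..<s})" "I \<inter> J = {}"
    using assms by (auto simp: I_def J_def)
  then have "card I + card J = \<Sum>X"
    using finIJ fin by (metis card_SigmaI card_Un_disjoint card_lessThan finite_lessThan sum.cong)
  moreover have "card J = card X choose 2"
    using card_pairs_less[OF fin] by (simp add: J_def)
  ultimately show ?thesis
    by simp
qed

text \<open>Replacing y by y - 1 changes the sum by \<open>card D\<close>, which is also the
  difference between the binomials for \<open>Suc (card D)\<close> and
  \<open>card D\<close>.\<close>

lemma card_cells_insert_0:
  assumes "D \<subseteq> {1..<n}" "n \<ge> 1"
  shows "card (cells {..<n} (insert 0 D)) + (\<Sum>y\<in>D. y - 1) =
           Suc (card D) * (n - Suc (card D)) + (card D choose 2)"
proof -
  have fin: "finite D" "0 \<notin> D"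
    using assms(1) by (auto intro: finite_subset)
  have "(\<Sum>y\<in>D. y) = (\<Sum>y\<in>D. (y - 1) + 1)"
    using assms(1) by (intro sum.cong) auto
  also have "\<dots> = (\<Sum>y\<in>D. y - 1) + card D"
    unfolding sum.distrib by simp
  finally have "\<Sum>(insert 0 D) = (\<Sum>y\<in>D. y - 1) + card D"
    using fin by simp
  moreover have "insert 0 D \<subseteq> {..<n}" "card (insert 0 D) = Suc (card D)"
    using assms fin by auto
  ultimately show ?thesis
    using card_cells_plus_sum[of "insert 0 D" n] by (simp add: numeral_2_eq_2)
qed

section \<open>From generating functions to cardinalities\<close>

lemma coeff_sum_monom_power:
  "finite T \<Longrightarrow> poly.coeff (\<Sum>x\<in>T. monom (1::int) 1 ^ f x) b = int (card {x \<in> T. f x = b})"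
  by (simp add: coeff_sum monom_power sum.If_cases Int_def)

lemma card_label_tab_eq_card_perms:
  assumes "D \<subseteq> {1..<n}" "n \<ge> 1"
  shows "card {A \<in> label_tab {..<n} (insert 0 D). card A = b} =
         card {w \<in> permutations_of_set {1..n}. desc_bottoms w = D \<and> n - 1 - card D + count231 w = b}"
proof -
  let ?q = "monom (1::int) 1"
  let ?T = "label_tab {..<n} (insert 0 D)"
  let ?P = "{w \<in> permutations_of_set {1..n}. desc_bottoms w = D}"
  have Max: "Max {1..n} = n"
    using assms by (intro Max_eqI) auto
  have lt: "{..<n} = insert 0 ({1..n} - {n})"
    using assms by auto
  have "finite ?T"
    unfolding label_tab_def using assms by (intro finite_tab finite_cells) auto
  have "gf_tab ?q ?T = ?q ^ (n - 1 - card D) * gf_perms ?q {1..n} D"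
  proof -
    have "finite {1..n}" "{1..n} \<noteq> {}" "0 \<notin> {1..n}" "D \<subseteq> {1..n} - {Max {1..n}}"
      using assms unfolding Max by auto
    from gf_label_tab_eq_gf_perms[OF this, of ?q] show ?thesis
      unfolding Max lt by simp
  qed
  then have "(\<Sum>A\<in>?T. ?q ^ card A) = (\<Sum>w\<in>?P. ?q ^ (n - 1 - card D + count231 w))"
    by (simp add: gf_tab_def gf_perms_def sum_distrib_left power_add)
  then have "int (card {A \<in> ?T. card A = b}) = int (card {w \<in> ?P. n - 1 - card D + count231 w = b})"
    using coeff_sum_monom_power[OF \<open>finite ?T\<close>, of card b]
      coeff_sum_monom_power[of ?P "\<lambda>w. n - 1 - card D + count231 w" b] by simp
  then show ?thesis
    by (simp add: conj_assoc)
qed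

section \<open>Pattern counts\<close>

definition same_order :: "nat list \<Rightarrow> nat list \<Rightarrow> bool" where
  "same_order u v \<longleftrightarrow> (\<forall>s<length u. \<forall>t<length u. u ! s < u ! t \<longleftrightarrow> v ! s < v ! t)"

text \<open>Among the positions with a successor in the pattern, adjacency is thus required only at
  s = 1 in the first case and only at s = 0 in the second; s = 2 is the end of the pattern.\<close>

lemma take_concat_lengths:
  "(\<forall>r. Suc s \<noteq> length (concat (take r [[x], [y, z]]))) \<longleftrightarrow> s \<noteq> 0 \<and> s \<noteq> 2"
  "(\<forall>r. Suc s \<noteq> length (concat (take r [[x, y], [z]]))) \<longleftrightarrow> s \<noteq> 1 \<and> s \<noteq> 2"
proof -
  have len: "length (concat (take r [[x], [y, z]])) = (if r = 0 then 0 else if r = 1 then 1 else 3)"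
    "length (concat (take r [[x, y], [z]])) = (if r = 0 then 0 else if r = 1 then 2 else 3)" for r
    by (auto simp: take_Cons')
  show "(\<forall>r. Suc s \<noteq> length (concat (take r [[x], [y, z]]))) \<longleftrightarrow> s \<noteq> 0 \<and> s \<noteq> 2" (is "?A \<longleftrightarrow> ?B")
  proof
    assume ?A
    from this[unfolded len, rule_format, of 1] this[unfolded len, rule_format, of 2] show ?B
      by simp
  qed (simp add: len)
  show "(\<forall>r. Suc s \<noteq> length (concat (take r [[x, y], [z]]))) \<longleftrightarrow> s \<noteq> 1 \<and> s \<noteq> 2" (is "?A \<longleftrightarrow> ?B")
  proof
    assume ?A
    from this[unfolded len, rule_format, of 1] this[unfolded len, rule_format, of 2] show ?B
      by simp
  qed (simp add: len)
qed

lemma pattern_count_1_2: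
  "pattern_count [[x], [y, z]] w =
     card {(i, j). i < j \<and> Suc j < length w \<and> same_order [w ! i, w ! j, w ! Suc j] [x, y, z]}"
proof -
  have "pattern_occurrences [[x], [y, z]] w = (\<lambda>(i, j). [i, j, Suc j]) `
      {(i, j). i < j \<and> Suc j < length w \<and> same_order [w ! i, w ! j, w ! Suc j] [x, y, z]}"
  proof (intro equalityI subsetI)
    fix xs assume xs: "xs \<in> pattern_occurrences [[x], [y, z]] w"
    then obtain i j l where ijl: "xs = [i, j, l]"
      by (auto simp: pattern_occurrences_def length_Suc_conv)
    have "l = Suc j"
      using xs unfolding ijl pattern_occurrences_def take_concat_lengths
      by (auto dest: spec[of _ 1])
    then show "xs \<in> (\<lambda>(i, j). [i, j, Suc j]) `
      {(i, j). i < j \<and> Suc j < length w \<and> same_order [w ! i, w ! j, w ! Suc j] [x, y, z]}"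
      using xs by (auto simp: ijl pattern_occurrences_def same_order_def less_Suc_eq image_iff)
  next
    fix xs assume "xs \<in> (\<lambda>(i, j). [i, j, Suc j]) `
      {(i, j). i < j \<and> Suc j < length w \<and> same_order [w ! i, w ! j, w ! Suc j] [x, y, z]}"
    then obtain i j where *: "xs = [i, j, Suc j]" "i < j" "Suc j < length w"
      "same_order [w ! i, w ! j, w ! Suc j] [x, y, z]"
      by auto
    then show "xs \<in> pattern_occurrences [[x], [y, z]] w"
      unfolding pattern_occurrences_def mem_Collect_eq take_concat_lengths
      by (auto simp: same_order_def less_Suc_eq)
  qed
  then show ?thesis
    unfolding pattern_count_def by (simp add: card_image inj_on_def)
qed

lemma pattern_count_2_1:
  "pattern_count [[x, y], [z]] w =
     card {(i, j). Suc j < i \<and> i < length w \<and> same_order [w ! j, w ! Suc j, w ! i] [x, y, z]}"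
proof -
  have "pattern_occurrences [[x, y], [z]] w = (\<lambda>(i, j). [j, Suc j, i]) `
      {(i, j). Suc j < i \<and> i < length w \<and> same_order [w ! j, w ! Suc j, w ! i] [x, y, z]}"
  proof (intro equalityI subsetI)
    fix xs assume xs: "xs \<in> pattern_occurrences [[x, y], [z]] w"
    then obtain i j l where ijl: "xs = [j, l, i]"
      by (auto simp: pattern_occurrences_def length_Suc_conv)
    have "l = Suc j"
      using xs unfolding ijl pattern_occurrences_def take_concat_lengths
      by (auto dest: spec[of _ 0])
    then show "xs \<in> (\<lambda>(i, j). [j, Suc j, i]) `
      {(i, j). Suc j < i \<and> i < length w \<and> same_order [w ! j, w ! Suc j, w ! i] [x, y, z]}"
      using xs by (auto simp: ijl pattern_occurrences_def same_order_def less_Suc_eq image_iff)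
  next
    fix xs assume "xs \<in> (\<lambda>(i, j). [j, Suc j, i]) `
      {(i, j). Suc j < i \<and> i < length w \<and> same_order [w ! j, w ! Suc j, w ! i] [x, y, z]}"
    then obtain i j where *: "xs = [j, Suc j, i]" "Suc j < i" "i < length w"
      "same_order [w ! j, w ! Suc j, w ! i] [x, y, z]"
      by auto
    then show "xs \<in> pattern_occurrences [[x, y], [z]] w"
      unfolding pattern_occurrences_def mem_Collect_eq take_concat_lengths
      by (auto simp: same_order_def less_Suc_eq)
  qed
  then show ?thesis
    unfolding pattern_count_def by (simp add: card_image inj_on_def)
qed

lemma same_order_3:
  "same_order [u, v, t] [x, y, z] \<longleftrightarrow>
     (u < v \<longleftrightarrow> x < y) \<and> (v < u \<longleftrightarrow> y < x) \<and> (u < t \<longleftrightarrow> x < z) \<and> (t < u \<longleftrightarrow> z < x) \<and>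
     (v < t \<longleftrightarrow> y < z) \<and> (t < v \<longleftrightarrow> z < y)"
  by (auto simp: same_order_def less_Suc_eq)

definition descents :: "nat list \<Rightarrow> nat set" where
  "descents w = {j. Suc j < length w \<and> w ! j > w ! Suc j}"

text \<open>In each of the six patterns the two adjacent letters form a descent, so all of them can
  be counted over this one set of a descent and a further letter.\<close>

definition descent_others :: "nat list \<Rightarrow> (nat \<times> nat) set" where
  "descent_others w = {(i, j). i < length w \<and> j \<in> descents w \<and> i \<noteq> j \<and> i \<noteq> Suc j}"

lemma finite_descents [simp]: "finite (descents w)"
  by (rule finite_subset[of _ "{..<length w}"]) (auto simp: descents_def)

lemma finite_descent_others: "finite (descent_others w)"
  by (rule finite_subset[of _ "{..<length w} \<times> descents w"]) (auto simp: descent_others_def)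

lemma des_eq_card_descents: "des w = card (descents w)"
  by (simp add: des_def descents_def)

lemma card_filter_eq_sum_of_bool: "finite A \<Longrightarrow> card {x \<in> A. Q x} = (\<Sum>x\<in>A. of_bool (Q x))"
  by (simp add: Int_def)

lemma card_descent_others:
  "card {(i, j). (i, j) \<in> descent_others w \<and> P i j} =
     (\<Sum>(i, j)\<in>descent_others w. of_bool (P i j))"
proof -
  have 1: "{(i, j). (i, j) \<in> descent_others w \<and> P i j} =
      {x \<in> descent_others w. case x of (i, j) \<Rightarrow> P i j}"
    by auto
  have 2: "(\<Sum>(i, j)\<in>descent_others w. of_bool (P i j)) =
      (\<Sum>x\<in>descent_others w. of_bool (case x of (i, j) \<Rightarrow> P i j) :: nat)"
    by (intro sum.cong) auto
  show ?thesis
    unfolding 1 2 by (rule card_filter_eq_sum_of_bool[OF finite_descent_others])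
qed

lemma pattern_count_eq_sum:
  "pattern_count [[3, 1], [2]] w =
     (\<Sum>(i, j)\<in>descent_others w. of_bool (Suc j < i \<and> w ! Suc j < w ! i \<and> w ! i < w ! j))"
  "pattern_count [[2, 1], [3]] w =
     (\<Sum>(i, j)\<in>descent_others w. of_bool (Suc j < i \<and> w ! j < w ! i))"
  "pattern_count [[3, 2], [1]] w =
     (\<Sum>(i, j)\<in>descent_others w. of_bool (Suc j < i \<and> w ! i < w ! Suc j))"
  "pattern_count [[2], [3, 1]] w =
     (\<Sum>(i, j)\<in>descent_others w. of_bool (i < j \<and> w ! Suc j < w ! i \<and> w ! i < w ! j))"
  "pattern_count [[3], [2, 1]] w =
     (\<Sum>(i, j)\<in>descent_others w. of_bool (i < j \<and> w ! j < w ! i))"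
  "pattern_count [[1], [3, 2]] w =
     (\<Sum>(i, j)\<in>descent_others w. of_bool (i < j \<and> w ! i < w ! Suc j))"
  unfolding card_descent_others[symmetric] pattern_count_1_2 pattern_count_2_1 same_order_3
  by (intro arg_cong[where f = card]; auto simp: descent_others_def descents_def)+

lemma pattern_count_231: "pattern_count [[2], [3, 1]] w = count231 w"
  unfolding pattern_count_1_2 same_order_3 count231_def by (intro arg_cong[where f = card]) auto

text \<open>The further letter stands before or after the descent, and its value is below the
  bottom, between bottom and top, or above the top. These six cases are the six patterns.\<close>

lemma sum_pattern_counts:
  assumes "distinct w"
  shows "pattern_count [[3, 1], [2]] w + pattern_count [[2, 1], [3]] w
       + pattern_count [[3, 2], [1]] w + pattern_count [[2], [3, 1]] w
       + pattern_count [[3], [2, 1]] w + pattern_count [[1], [3, 2]] w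
       = des w * (length w - 2)" (is "?sum = _")
proof -
  have one: "of_bool (Suc j < i \<and> w ! Suc j < w ! i \<and> w ! i < w ! j)
      + of_bool (Suc j < i \<and> w ! j < w ! i) + of_bool (Suc j < i \<and> w ! i < w ! Suc j)
      + of_bool (i < j \<and> w ! Suc j < w ! i \<and> w ! i < w ! j)
      + of_bool (i < j \<and> w ! j < w ! i) + of_bool (i < j \<and> w ! i < w ! Suc j) = (1::nat)"
    if "(i, j) \<in> descent_others w" for i j
  proof -
    have "w ! i \<noteq> w ! j" "w ! i \<noteq> w ! Suc j" "w ! Suc j < w ! j" "i \<noteq> j" "i \<noteq> Suc j"
      using that assms by (auto simp: descent_others_def descents_def nth_eq_iff_index_eq)
    moreover from this have "Suc j < i \<or> i < j"
      by linarith
    ultimately consider "Suc j < i \<or> i < j" "w ! i < w ! Suc j"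
      | "Suc j < i \<or> i < j" "w ! Suc j < w ! i" "w ! i < w ! j"
      | "Suc j < i \<or> i < j" "w ! j < w ! i"
      by linarith
    then show ?thesis
      using \<open>w ! Suc j < w ! j\<close> by cases auto
  qed
  have "?sum = (\<Sum>x\<in>descent_others w. 1)"
    unfolding pattern_count_eq_sum sum.distrib[symmetric] using one by (intro sum.cong) auto
  also have "\<dots> = card (descent_others w)"
    by simp
  also have "card (descent_others w) = des w * (length w - 2)"
  proof -
    have "descent_others w = prod.swap ` (SIGMA j:descents w. {..<length w} - {j, Suc j})"
      by (auto simp: descent_others_def)
    then have "card (descent_others w) = (\<Sum>j\<in>descents w. card ({..<length w} - {j, Suc j}))"
      by (simp add: card_image)
    also have "\<dots> = (\<Sum>j\<in>descents w. length w - 2)"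
      by (intro sum.cong refl) (auto simp: descents_def card_Diff_subset)
    finally show ?thesis
      by (simp add: des_eq_card_descents)
  qed
  finally show ?thesis .
qed

lemma desc_bottoms_eq_image: "desc_bottoms w = (\<lambda>j. w ! Suc j) ` descents w"
  by (auto simp: desc_bottoms_def descents_def)

lemma inj_on_descents: "distinct w \<Longrightarrow> inj_on (\<lambda>j. w ! Suc j) (descents w)"
  by (auto simp: inj_on_def descents_def nth_eq_iff_index_eq)

lemma des_eq_card_desc_bottoms: "distinct w \<Longrightarrow> des w = card (desc_bottoms w)"
  by (simp add: des_eq_card_descents desc_bottoms_eq_image card_image inj_on_descents)

text \<open>The two patterns together count the letters below a bottom y on either side of its
  descent; in a permutation of 1, ..., n there are y - 1.\<close>

lemma pattern_counts_eq_sum_bottoms: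
  assumes "w \<in> permutations_of_set {1..n}"
  shows "pattern_count [[1], [3, 2]] w + pattern_count [[3, 2], [1]] w = (\<Sum>y\<in>desc_bottoms w. y - 1)"
proof -
  have w: "set w = {1..n}" "distinct w"
    using assms by (auto simp: permutations_of_set_def)
  have below: "card {i. i < length w \<and> w ! i < w ! Suc j} = w ! Suc j - 1" if "j \<in> descents w" for j
  proof -
    have "w ! Suc j \<in> {1..n}"
      using that w(1) nth_mem[of "Suc j" w] by (auto simp: descents_def)
    then have "bij_betw ((!) w) {i. i < length w \<and> w ! i < w ! Suc j} {1..<w ! Suc j}"
      using w unfolding bij_betw_def
      by (auto simp: inj_on_def nth_eq_iff_index_eq image_def set_eq_iff in_set_conv_nth)
         (metis Suc_leI atLeastAtMost_iff less_imp_le_nat less_le_trans One_nat_def)+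
    from bij_betw_same_card[OF this] show ?thesis
      by simp
  qed
  have "pattern_count [[1], [3, 2]] w + pattern_count [[3, 2], [1]] w =
      (\<Sum>(i, j)\<in>descent_others w. of_bool (w ! i < w ! Suc j))"
    unfolding pattern_count_eq_sum sum.distrib[symmetric]
    by (intro sum.cong) (auto simp: descent_others_def)
  also have "\<dots> = card {x \<in> descent_others w. w ! fst x < w ! Suc (snd x)}"
    unfolding case_prod_unfold by (rule card_filter_eq_sum_of_bool[OF finite_descent_others, symmetric])
  also have "{x \<in> descent_others w. w ! fst x < w ! Suc (snd x)} =
      prod.swap ` (SIGMA j:descents w. {i. i < length w \<and> w ! i < w ! Suc j})"
    by (auto simp: descent_others_def descents_def)
  also have "card \<dots> = (\<Sum>j\<in>descents w. w ! Suc j - 1)"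
    by (simp add: card_image below)
  also have "\<dots> = (\<Sum>y\<in>desc_bottoms w. y - 1)"
    using inj_on_descents[OF w(2)] by (simp add: desc_bottoms_eq_image sum.reindex)
  finally show ?thesis .
qed

section \<open>Putting both sides together\<close>

lemma desc_bottoms_permutation:
  assumes "w \<in> permutations_of_set {1..n}"
  shows "desc_bottoms w \<subseteq> {1..<n}"
proof
  fix x assume x: "x \<in> desc_bottoms w"
  have "set w = {1..n}"
    using assms by (simp add: permutations_of_set_def)
  then show "x \<in> {1..<n}"
    using desc_bottoms_less_Max[OF x] desc_bottoms_subset[of w] x by fastforce
qed

text \<open>The equation for a is traded for one for a + b + c, so that only the set of bottoms and
  the number of 2-31 remain, matching the description of the tableaux.\<close>

lemma permutations_P_iff:
  assumes w: "w \<in> permutations_of_set {1..n}" and k: "1 \<le> k" "k \<le> n"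
  shows "w \<in> permutations_P n k a b c \<longleftrightarrow> card (desc_bottoms w) = k - 1 \<and>
           n - 1 - card (desc_bottoms w) + count231 w = b \<and>
           (\<Sum>y\<in>desc_bottoms w. y - 1) = c + (k - 1 choose 2) \<and> a + b + c = k * (n - k)"
proof (cases "card (desc_bottoms w) = k - 1")
  case True
  have "set w = {1..n}" "distinct w"
    using w by (auto simp: permutations_of_set_def)
  then have len: "length w = n" and des: "des w = k - 1"
    using distinct_card[of w] True by (auto simp: des_eq_card_desc_bottoms)
  define C where "C = (k - 1 choose 2)"
  define R where "R = k * (n - k)"
  obtain d m where dm: "k = Suc d" "n = Suc d + m"
    using k by (metis Suc_le_D One_nat_def le_add_diff_inverse)
  have "2 * C = d * (d - 1)"
  proof -
    have "even (d * (d - 1))"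
      by (cases d) auto
    then show ?thesis
      unfolding C_def by (simp add: dm choose_two)
  qed
  \<comment> \<open>The six patterns occur (k - 1)(n - 2) times in all. Adding the summand n - k of
    b and subtracting both binomials leaves the area k(n - k) of the rectangle.\<close>
  then have "(k - 1) * (n - 2) + (n - k) = R + 2 * C"
    unfolding R_def dm by (cases d) (simp_all add: algebra_simps)
  then have sum: "pattern_count [[3, 1], [2]] w + pattern_count [[2, 1], [3]] w
      + pattern_count [[3, 2], [1]] w + count231 w + pattern_count [[3], [2, 1]] w
      + pattern_count [[1], [3, 2]] w + (n - k) = R + 2 * C"
    using sum_pattern_counts[OF \<open>distinct w\<close>] unfolding len des pattern_count_231 by linarith
  have k': "int k - 1 = int (k - 1)" "n - 1 - (k - 1) = n - k"
    using k by auto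
  show ?thesis
    unfolding permutations_P_def mem_Collect_eq des pattern_count_231 True
      pattern_counts_eq_sum_bottoms[OF w, symmetric] C_def[symmetric] R_def[symmetric] k'
    using w sum k by (auto simp: of_nat_diff)
next
  case False
  have "distinct w"
    using w by (auto simp: permutations_of_set_def)
  then have "int k - 1 \<noteq> int (des w)"
    using False k by (simp add: des_eq_card_desc_bottoms)
  then show ?thesis
    using False by (simp add: permutations_P_def)
qed

theorem corollary25:
  fixes n k a b c :: nat
  assumes "n \<ge> 1" and "k \<le> n"
  shows "card (tableaux_T n k a b c) = card (permutations_P n k a b c)"
proof -
  define h where "h D = (if a + b + c = k * (n - k) \<and> card (cells {..<n} D) + c = k * (n - k)
        then card {A \<in> label_tab {..<n} D. card A = b} else 0)" for D
  define S where "S = {D. D \<subseteq> {..<n} \<and> card D = k}"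
  have fin: "finite S"
    by (rule finite_subset[of _ "Pow {..<n}"]) (auto simp: S_def)
  \<comment> \<open>Without label 0 the boundary begins with an empty column, so there are no
    tableaux.\<close>
  have h0: "h D = 0" if "D \<in> S" "0 \<notin> D" for D
    using that assms(1) label_tab_eq_empty[of 0 "{..<n}" D] by (auto simp: h_def S_def)
  have T: "card (tableaux_T n k a b c) = sum h S"
    using card_tableaux_T[of k "n - k" a b c]
    unfolding le_add_diff_inverse[OF assms(2)] S_def h_def .
  show ?thesis
  proof (cases "k = 0")
    case True
    \<comment> \<open>With k = 0 the label set is empty, so \<open>h0\<close> applies; on the other
      side the number of descents would be -1.\<close>
    then have "0 \<notin> D" if "D \<in> S" for D
      using that finite_subset[of D "{..<n}"] by (auto simp: S_def)
    moreover have "permutations_P n k a b c = {}"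
      using True by (auto simp: permutations_P_def)
    ultimately show ?thesis
      by (simp add: T h0)
  next
    case False
    then have k: "1 \<le> k" by simp
    define S1 where "S1 = {D. D \<subseteq> {1..<n} \<and> card D = k - 1}"
    define p where "p D = {w \<in> permutations_of_set {1..n}.
      desc_bottoms w = D \<and> n - 1 - card D + count231 w = b}" for D
    define ok where "ok D \<longleftrightarrow> (\<Sum>y\<in>D. y - 1) = c + (k - 1 choose 2) \<and> a + b + c = k * (n - k)"
      for D :: "nat set"
    have "finite S1"
      by (rule finite_subset[of _ "Pow {..<n}"]) (auto simp: S1_def)
    have hp: "h (insert 0 D) = (if ok D then card (p D) else 0)" if "D \<in> S1" for D
    proof -
      have D: "D \<subseteq> {1..<n}" "card D = k - 1"
        using that by (auto simp: S1_def)
      have "card (cells {..<n} (insert 0 D)) + (\<Sum>y\<in>D. y - 1) = k * (n - k) + (k - 1 choose 2)"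
        using card_cells_insert_0[OF D(1) assms(1)] D(2) k by simp
      then have "card (cells {..<n} (insert 0 D)) + c = k * (n - k) \<longleftrightarrow>
          (\<Sum>y\<in>D. y - 1) = c + (k - 1 choose 2)"
        by linarith
      then show ?thesis
        using card_label_tab_eq_card_perms[OF D(1) assms(1), of b]
        by (auto simp: h_def ok_def p_def)
    qed
    have "inj_on (insert 0) S1"
    proof (rule inj_onI)
      fix x y assume "x \<in> S1" "y \<in> S1" "insert 0 x = insert 0 y"
      moreover from this have "0 \<notin> x" "0 \<notin> y"
        by (auto simp: S1_def)
      ultimately show "x = y"
        by (simp add: insert_ident)
    qed
    moreover have "insert 0 ` S1 = {D \<in> S. 0 \<in> D}"
    proof (intro equalityI subsetI)
      fix D assume "D \<in> insert 0 ` S1"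
      then obtain D1 where D1: "D = insert 0 D1" "D1 \<subseteq> {1..<n}" "card D1 = k - 1"
        by (auto simp: S1_def)
      moreover have "finite D1" "0 \<notin> D1"
        using D1(2) by (auto intro: finite_subset)
      ultimately show "D \<in> {D \<in> S. 0 \<in> D}"
        using k assms by (auto simp: S_def)
    next
      fix D assume "D \<in> {D \<in> S. 0 \<in> D}"
      then have D: "D \<subseteq> {..<n}" "card D = k" "0 \<in> D"
        by (auto simp: S_def)
      have "D - {0} \<subseteq> {1..<n}"
        using D(1) by (auto simp: Suc_le_eq)
      then have "D - {0} \<in> S1"
        using D finite_subset[OF D(1)] by (simp add: S1_def)
      then show "D \<in> insert 0 ` S1"
        using D(3) by (intro image_eqI[of _ _ "D - {0}"]) auto
    qed
    ultimately have "sum h {D \<in> S. 0 \<in> D} = (\<Sum>D\<in>S1. h (insert 0 D))"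
      by (metis (no_types, lifting) sum.reindex_cong)
    moreover have "sum h S = sum h {D \<in> S. 0 \<in> D}"
      using fin h0 by (intro sum.mono_neutral_right) auto
    ultimately have "card (tableaux_T n k a b c) = (\<Sum>D\<in>S1. if ok D then card (p D) else 0)"
      using hp by (simp add: T)
    also have "\<dots> = (\<Sum>D\<in>{D \<in> S1. ok D}. card (p D))"
      using \<open>finite S1\<close> by (simp add: sum.inter_filter)
    also have "\<dots> = card (\<Union>D\<in>{D \<in> S1. ok D}. p D)"
      using \<open>finite S1\<close> by (intro card_UN_disjoint[symmetric]) (auto simp: p_def)
    also have "(\<Union>D\<in>{D \<in> S1. ok D}. p D) = permutations_P n k a b c"
    proof (intro set_eqI)
      fix w
      show "w \<in> (\<Union>D\<in>{D \<in> S1. ok D}. p D) \<longleftrightarrow> w \<in> permutations_P n k a b c"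
      proof (cases "w \<in> permutations_of_set {1..n}")
        case True
        then show ?thesis
          unfolding permutations_P_iff[OF True k assms(2)]
          using desc_bottoms_permutation[OF True] by (auto simp: p_def S1_def ok_def)
      next
        case False
        then show ?thesis
          by (auto simp: p_def permutations_P_def)
      qed
    qed
    finally show ?thesis .
  qed
qed

end
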